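(* Let $F_1,\dots,F_k$ be real symmetric $n\times n$ matrices, and let $(V,\Lambda)$ be approximate eigenpairs, with $V$ an $n\times p$ matrix ($p\le n$) and $\Lambda=\mathrm{diag}(\hat\lambda_1,\dots,\hat\lambda_p)$ a diagonal matrix, such that $R=\sum_{j=1}^k F_jVf_j(\Lambda)$. Let $V=Q_1T$ be an economy size QR factorization of $V$ ($Q_1$ of size $n\times p$ with orthonormal columns, $T$ of size $p\times p$ upper triangular), and define $$\tilde T=\begin{bmatrix}Tf_1(\Lambda)\\ \vdots\\ Tf_k(\Lambda)\end{bmatrix},\qquad M_S=\begin{bmatrix}\tilde T^T\otimes I_p\\ \mathrm{diag}(\Pi_{p,p}-I_{p^2},\dots,\Pi_{p,p}-I_{p^2})\end{bmatrix},$$ where the lower block of $M_S$ is the $kp^2\times kp^2$ block diagonal matrix with $k$ diagonal blocks equal to $\Pi_{p,p}-I_{p^2}$, and $\Pi_{p,p}$ is the $(p,p)$ commutation matrix. Then the structured (real symmetric) backward error $\eta$ associated with the approximate eigenpairs $(V,\Lambda)$ satisfies $$\eta^2\le\|R\|_F^2\left(\|M_S^\dagger\|_F^2+2\|\tilde T\|_F^2\right).$$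
   Context: Here $f_1,\dots,f_k:\mathbb{C}\to\mathbb{C}$ are scalar functions and $F(\lambda)=\sum_{j=1}^k f_j(\lambda)F_j$ is the associated nonlinear matrix-valued function. The columns of $V$ are (nonzero) approximate eigenvectors associated with the approximate eigenvalues $\hat\lambda_1,\dots,\hat\lambda_p$ of $F(\lambda)$. The structured backward error for real symmetric structure is $$\eta:=\min\Big\{\|[\delta F_1,\dots,\delta F_k]\|_F\ :\ \sum_{j=1}^k(F_j+\delta F_j)Vf_j(\Lambda)=0,\ \delta F_j=\delta F_j^T\in\mathbb{R}^{n\times n},\ j=1,\dots,k\Big\}.$$ Notation: $f_j(\Lambda)=\mathrm{diag}(f_j(\hat\lambda_1),\dots,f_j(\hat\lambda_p))$; $\otimes$ is the Kronecker product; $I_m$ is the $m\times m$ identity; ${}^T$ is the transpose; $\dagger$ is the Moore-Penrose pseudoinverse; $\|\cdot\|_F$ is the Frobenius norm; the commutation matrix (perfect shuffle) $\Pi_{p,p}$ is the $p^2\times p^2$ permutation matrix with $\Pi_{p,p}\mathrm{vec}(X)=\mathrm{vec}(X^T)$ for all $p\times p$ matrices $X$, where $\mathrm{vec}$ stacks columns.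
   Formalization: The printed bound is false; the formal one has the pseudoinverse of T̃ in place of T̃ in the last term, and assumes that the data (v_i, f_1(λ_i),…,f_k(λ_i)) are closed under complex conjugation (e.g. all real, or conjugate pairs), since no such bound holds for arbitrary complex V. *)

theory Defs
  imports Complex_Main "Jordan_Normal_Form.Schur_Decomposition"
begin

definition frob_norm :: "'a::real_normed_vector mat \<Rightarrow> real" where
  "frob_norm A = sqrt (\<Sum>r<dim_row A. \<Sum>c<dim_col A. (norm (A $$ (r, c)))\<^sup>2)"

text \<open>The four Penrose conditions, which have exactly one solution for every complex matrix.\<close>

definition is_pseudoinverse :: "complex mat \<Rightarrow> complex mat \<Rightarrow> bool" where
  "is_pseudoinverse A X \<longleftrightarrow>
     X \<in> carrier_mat (dim_col A) (dim_row A) \<and>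
     A * X * A = A \<and> X * A * X = X \<and>
     mat_adjoint (A * X) = A * X \<and> mat_adjoint (X * A) = X * A"

definition pseudoinverse :: "complex mat \<Rightarrow> complex mat" where
  "pseudoinverse A = (THE X. is_pseudoinverse A X)"

definition kronecker_prod :: "'a::times mat \<Rightarrow> 'a mat \<Rightarrow> 'a mat" where
  "kronecker_prod A B = mat (dim_row A * dim_row B) (dim_col A * dim_col B)
     (\<lambda>(r, c). A $$ (r div dim_row B, c div dim_col B) * B $$ (r mod dim_row B, c mod dim_col B))"

text \<open>Column stacking: entry \<open>(r, c)\<close> of \<open>X\<close> gets the index \<open>c * dim_row X + r\<close>.\<close>

definition vec_stack :: "'a mat \<Rightarrow> 'a vec" where
  "vec_stack X = vec (dim_row X * dim_col X) (\<lambda>i. X $$ (i mod dim_row X, i div dim_row X))"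

definition commutation_mat :: "nat \<Rightarrow> 'a::zero_neq_one mat" where
  "commutation_mat p = mat (p * p) (p * p)
     (\<lambda>(r, c). if c = (r mod p) * p + r div p then 1 else 0)"

lemma commutation_mat_vec_stack:
  fixes X :: "'a::comm_ring_1 mat"
  assumes X: "X \<in> carrier_mat p p"
  shows "commutation_mat p *\<^sub>v vec_stack X = vec_stack (transpose_mat X)"
proof (rule eq_vecI)
  show "dim_vec (commutation_mat p *\<^sub>v vec_stack X) = dim_vec (vec_stack (transpose_mat X))"
    using X by (simp add: commutation_mat_def vec_stack_def)
next
  fix i assume "i < dim_vec (vec_stack (transpose_mat X))"
  then have i: "i < p * p" using X by (simp add: vec_stack_def)
  then have p: "p > 0" by (cases p) auto
  have d: "i div p < p" and m: "i mod p < p"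
    using i p by (auto simp: less_mult_imp_div_less)
  define c where "c = (i mod p) * p + i div p"
  have "c < p * p"
  proof -
    have "c < (i mod p) * p + p" using d by (simp add: c_def)
    also have "\<dots> = Suc (i mod p) * p" by simp
    also have "\<dots> \<le> p * p" using m by (intro mult_right_mono) auto
    finally show ?thesis .
  qed
  moreover have "c mod p = i div p" "c div p = i mod p"
    using d p by (auto simp: c_def)
  moreover have "(commutation_mat p *\<^sub>v vec_stack X) $ i
      = (\<Sum>j = 0..<p * p. (if j = c then 1 else 0) * X $$ (j mod p, j div p))"
    using i X by (simp add: commutation_mat_def vec_stack_def scalar_prod_def c_def)
  moreover have "\<dots> = (\<Sum>j = 0..<p * p. if j = c then X $$ (j mod p, j div p) else 0)"
    by (rule sum.cong) auto
  ultimately show "(commutation_mat p *\<^sub>v vec_stack X) $ i = vec_stack (transpose_mat X) $ i"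
    using i d m X by (simp add: vec_stack_def)
qed

text \<open>Block indices are 0-based: \<open>j = 0, \<dots>, k - 1\<close>. The first two definitions are
  the block row \<open>[A\<^sub>0, \<dots>, A\<^sub>k\<^sub>-\<^sub>1]\<close> of \<open>n \<times> n\<close> blocks and the block column
  of \<open>p \<times> p\<close> blocks.\<close>

definition block_row :: "nat \<Rightarrow> nat \<Rightarrow> (nat \<Rightarrow> 'a mat) \<Rightarrow> 'a mat" where
  "block_row n k A = mat n (k * n) (\<lambda>(r, c). A (c div n) $$ (r, c mod n))"

definition block_col :: "nat \<Rightarrow> nat \<Rightarrow> (nat \<Rightarrow> 'a mat) \<Rightarrow> 'a mat" where
  "block_col p k B = mat (k * p) p (\<lambda>(r, c). B (r div p) $$ (r mod p, c))"

definition fun_Lambda :: "nat \<Rightarrow> (nat \<Rightarrow> complex \<Rightarrow> complex) \<Rightarrow> (nat \<Rightarrow> complex) \<Rightarrow> nat \<Rightarrow> complex mat"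
  where "fun_Lambda p f lam j = mat_diag p (\<lambda>i. f j (lam i))"

text \<open>\<open>\<Sum>\<^sub>j A\<^sub>j V f\<^sub>j(\<Lambda>)\<close>, summed entrywise since \<open>mat\<close> has no additive monoid structure.\<close>

definition residual_mat ::
  "nat \<Rightarrow> nat \<Rightarrow> nat \<Rightarrow> (nat \<Rightarrow> complex \<Rightarrow> complex) \<Rightarrow> (nat \<Rightarrow> real mat) \<Rightarrow>
   complex mat \<Rightarrow> (nat \<Rightarrow> complex) \<Rightarrow> complex mat" where
  "residual_mat n p k f A V lam = mat n p
     (\<lambda>(r, c). \<Sum>j<k. (map_mat complex_of_real (A j) * V * fun_Lambda p f lam j) $$ (r, c))"

definition admissible_perturbation ::
  "nat \<Rightarrow> nat \<Rightarrow> nat \<Rightarrow> (nat \<Rightarrow> complex \<Rightarrow> complex) \<Rightarrow> (nat \<Rightarrow> real mat) \<Rightarrow>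
   complex mat \<Rightarrow> (nat \<Rightarrow> complex) \<Rightarrow> (nat \<Rightarrow> real mat) \<Rightarrow> bool" where
  "admissible_perturbation n p k f F V lam dF \<longleftrightarrow>
     (\<forall>j<k. dF j \<in> carrier_mat n n \<and> transpose_mat (dF j) = dF j) \<and>
     residual_mat n p k f (\<lambda>j. F j + dF j) V lam = 0\<^sub>m n p"

text \<open>The infimum is a minimum: for symmetric \<open>F\<^sub>j\<close> the admissible perturbations form a closed
  affine set, which is nonempty because it contains \<open>\<delta>F\<^sub>j = - F\<^sub>j\<close>.\<close>

definition structured_backward_error ::
  "nat \<Rightarrow> nat \<Rightarrow> nat \<Rightarrow> (nat \<Rightarrow> complex \<Rightarrow> complex) \<Rightarrow> (nat \<Rightarrow> real mat) \<Rightarrow>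
   complex mat \<Rightarrow> (nat \<Rightarrow> complex) \<Rightarrow> real" where
  "structured_backward_error n p k f F V lam =
     Inf {frob_norm (block_row n k dF) | dF. admissible_perturbation n p k f F V lam dF}"

text \<open>Real matrices have real, or conjugate pairs of, eigenvalues and eigenvectors; the given
  approximate eigenpairs are taken to share this symmetry. Real \<open>V\<close> with real
  \<open>f\<^sub>j(\<lambda>\<^sub>i)\<close> is the special case \<open>i' = i\<close>. For arbitrary complex data no
  bound of this kind holds: a residual tiny in norm may force a large \<^emph>\<open>real\<close> perturbation.\<close>

definition conjugation_closed ::
  "nat \<Rightarrow> nat \<Rightarrow> (nat \<Rightarrow> complex \<Rightarrow> complex) \<Rightarrow> complex mat \<Rightarrow> (nat \<Rightarrow> complex) \<Rightarrow> bool" where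
  "conjugation_closed p k f V lam \<longleftrightarrow>
     (\<forall>i<p. \<exists>i'<p. col V i' = conjugate (col V i) \<and>
        (\<forall>j<k. f j (lam i') = cnj (f j (lam i))))"

definition T_tilde ::
  "nat \<Rightarrow> nat \<Rightarrow> (nat \<Rightarrow> complex \<Rightarrow> complex) \<Rightarrow> (nat \<Rightarrow> complex) \<Rightarrow> complex mat \<Rightarrow> complex mat" where
  "T_tilde p k f lam T = block_col p k (\<lambda>j. T * fun_Lambda p f lam j)"

definition M_S :: "nat \<Rightarrow> nat \<Rightarrow> complex mat \<Rightarrow> complex mat" where
  "M_S p k Tt = kronecker_prod (transpose_mat Tt) (1\<^sub>m p)
     @\<^sub>r diag_block_mat (replicate k (commutation_mat p - 1\<^sub>m (p * p)))"

text \<open>Economy size QR factorization \<open>V = Q\<^sub>1 T\<close>.\<close>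

definition economy_qr :: "nat \<Rightarrow> nat \<Rightarrow> complex mat \<Rightarrow> complex mat \<Rightarrow> complex mat \<Rightarrow> bool" where
  "economy_qr n p V Q1 T \<longleftrightarrow>
     Q1 \<in> carrier_mat n p \<and> T \<in> carrier_mat p p \<and>
     mat_adjoint Q1 * Q1 = 1\<^sub>m p \<and> upper_triangular T \<and> V = Q1 * T"

end

theory Submission
  imports Defs "HOL-Analysis.L2_Norm"
begin

text \<open>Conjugation permutes the eigenpairs, so the entrywise real part of a complex symmetric
  perturbation that annihilates the residual annihilates it too, with no larger norm; hence complex
  symmetric \<open>\<delta>F\<^sub>j\<close> suffice. Completing \<open>Q\<^sub>1\<close> to a unitary
  \<open>Q = [Q\<^sub>1, Q\<^sub>2]\<close> and putting
  \<open>\<delta>F\<^sub>j = cnj Q [A\<^sub>j, C\<^sub>j\<^sup>T; C\<^sub>j, 0] Q\<^sup>*\<close> with symmetric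
  \<open>A\<^sub>j\<close>, the equation decouples into \<open>A Tt = - Q\<^sub>1\<^sup>T R\<close> and
  \<open>C Tt = - Q\<^sub>2\<^sup>T R\<close>. The second is solved by
  \<open>C = - Q\<^sub>2\<^sup>T R Tt\<^sup>\<dagger>\<close>; the first, together with the symmetry of the blocks, is
  the linear system \<open>M\<^sub>S vec(A) = (- vec(Q\<^sub>1\<^sup>T R), 0)\<close>. Both are consistent because
  \<open>\<delta>F\<^sub>j = - F\<^sub>j\<close> is a symmetric solution. Finally
  \<open>\<Sum>\<^sub>j \<parallel>\<delta>F\<^sub>j\<parallel>\<^sup>2 = \<parallel>A\<parallel>\<^sup>2 + 2 \<parallel>C\<parallel>\<^sup>2\<close> and
  \<open>\<parallel>R\<parallel>\<^sup>2 = \<parallel>Q\<^sub>1\<^sup>T R\<parallel>\<^sup>2 + \<parallel>Q\<^sub>2\<^sup>T R\<parallel>\<^sup>2\<close>.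
  To avoid choosing \<open>Q\<^sub>2\<close>, the proof works with \<open>B = cnj Q\<^sub>2 C\<close>, that is,
  \<open>B = - (R - cnj Q\<^sub>1 Q\<^sub>1\<^sup>T R) Tt\<^sup>\<dagger>\<close>.\<close>

section \<open>Adjoints and pseudoinverses\<close>

lemma mult_assoc_dim:
  "dim_col A = dim_row B \<Longrightarrow> dim_col B = dim_row C \<Longrightarrow>
    A * B * C = A * (B * (C :: 'a :: semiring_0 mat))"
  by (rule assoc_mult_mat) auto

lemma mult_mat_one_dim [simp]:
  "dim_row A = n \<Longrightarrow> 1\<^sub>m n * A = (A :: 'a :: semiring_1 mat)"
  "dim_col A = n \<Longrightarrow> A * 1\<^sub>m n = A"
  by (auto intro: left_mult_one_mat right_mult_one_mat)

lemma minus_mult_dim: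
  "dim_row A = dim_row B \<Longrightarrow> dim_col A = dim_col B \<Longrightarrow> dim_col B = dim_row C \<Longrightarrow>
    (A - B) * C = A * C - B * (C :: 'a :: ring mat)"
  by (rule minus_mult_distrib_mat) auto

lemma mult_minus_dim:
  "dim_col A = dim_row B \<Longrightarrow> dim_row B = dim_row C \<Longrightarrow> dim_col B = dim_col C \<Longrightarrow>
    A * (B - C) = A * B - A * (C :: 'a :: ring mat)"
  by (rule mult_minus_distrib_mat) auto

lemma add_mult_dim:
  "dim_row A = dim_row B \<Longrightarrow> dim_col A = dim_col B \<Longrightarrow> dim_col B = dim_row C \<Longrightarrow>
    (A + B) * C = A * C + B * (C :: 'a :: semiring_0 mat)"
  by (rule add_mult_distrib_mat) auto

lemma mult_add_dim:
  "dim_col A = dim_row B \<Longrightarrow> dim_row B = dim_row C \<Longrightarrow> dim_col B = dim_col C \<Longrightarrow>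
    A * (B + C) = A * B + A * (C :: 'a :: semiring_0 mat)"
  by (rule mult_add_distrib_mat) auto

lemma mult_index_sum:
  "i < dim_row A \<Longrightarrow> j < dim_col B \<Longrightarrow> dim_col A = dim_row B \<Longrightarrow>
    (A * B) $$ (i, j) = (\<Sum>k<dim_row B. A $$ (i, k) * B $$ (k, j))"
  by (simp add: scalar_prod_def atLeast0LessThan)

section \<open>Adjoints of complex matrices\<close>

lemma dim_mat_adjoint [simp]:
  "dim_row (mat_adjoint A) = dim_col A" "dim_col (mat_adjoint A) = dim_row A"
  by (auto simp: mat_adjoint_def)

lemma index_mat_adjoint [simp]:
  "i < dim_col A \<Longrightarrow> j < dim_row A \<Longrightarrow> mat_adjoint A $$ (i, j) = conjugate (A $$ (j, i))"
  by (simp add: mat_adjoint_def mat_of_rows_index)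

lemma mat_adjoint_adjoint [simp]: "mat_adjoint (mat_adjoint A) = (A :: complex mat)"
  by (rule eq_matI) auto

lemma mat_adjoint_mult:
  "dim_col A = dim_row B \<Longrightarrow> mat_adjoint (A * B) = mat_adjoint B * mat_adjoint (A :: complex mat)"
  by (rule eq_matI) (auto simp: mult_index_sum mult.commute simp del: index_mult_mat(1))

lemma mat_adjoint_transpose: "mat_adjoint (transpose_mat A) = transpose_mat (mat_adjoint A)"
  by (rule eq_matI) auto

lemma mat_adjoint_zero [simp]: "mat_adjoint (0\<^sub>m m n :: complex mat) = 0\<^sub>m n m"
  by (rule eq_matI) auto

text \<open>The diagonal of the product consists of the squared norms of the rows of
  \<open>A\<close>, so every summand vanishes.\<close>

lemma mult_adjoint_eq_0_imp_eq_0: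
  fixes A :: "complex mat"
  assumes "A * mat_adjoint A = 0\<^sub>m (dim_row A) (dim_row A)"
  shows "A = 0\<^sub>m (dim_row A) (dim_col A)"
proof (rule eq_matI)
  fix i j assume i: "i < dim_row (0\<^sub>m (dim_row A) (dim_col A) :: complex mat)"
    and j: "j < dim_col (0\<^sub>m (dim_row A) (dim_col A) :: complex mat)"
  have "(A * mat_adjoint A) $$ (i, i) = 0"
    using i by (subst assms) auto
  then have "(\<Sum>k<dim_col A. A $$ (i, k) * cnj (A $$ (i, k))) = 0"
    using i by (simp add: mult_index_sum del: index_mult_mat(1))
  then have "(\<Sum>k<dim_col A. complex_of_real ((cmod (A $$ (i, k)))\<^sup>2)) = 0"
    by (simp only: complex_norm_square)
  then have "(\<Sum>k<dim_col A. (cmod (A $$ (i, k)))\<^sup>2) = 0"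
    by (metis of_real_eq_0_iff of_real_sum)
  then have "\<forall>k\<in>{..<dim_col A}. (cmod (A $$ (i, k)))\<^sup>2 = 0"
    by (subst (asm) sum_nonneg_eq_0_iff) auto
  then show "A $$ (i, j) = 0\<^sub>m (dim_row A) (dim_col A) $$ (i, j)"
    using i j by simp
qed auto

text \<open>Wedderburn rank reduction: with \<open>E\<close> the multiple of a matrix unit that makes
  \<open>A - A E A\<close> vanish in a nonzero row of \<open>A\<close>, a generalized inverse \<open>G\<close> of
  \<open>A - A E A\<close> yields the generalized inverse \<open>E + (1 - E A) G (1 - A E)\<close> of \<open>A\<close>.\<close>

lemma generalized_inverse_exists:
  fixes A :: "'a :: field mat"
  shows "\<exists>G\<in>carrier_mat (dim_col A) (dim_row A). A * G * A = A"
\<comment> \<open>The induction is on the number of nonzero rows.\<close>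
proof (induction "card {i\<in>{..<dim_row A}. \<exists>j<dim_col A. A $$ (i, j) \<noteq> 0}" arbitrary: A
    rule: less_induct)
  case less
  define m n where "m = dim_row A" and "n = dim_col A"
  note mn = m_def[symmetric] n_def[symmetric]
  show ?case
  proof (cases "\<exists>i<m. \<exists>j<n. A $$ (i, j) \<noteq> 0")
    case False
    then have "A * 0\<^sub>m n m * A = A"
      by (intro eq_matI) (auto simp: mn mult_index_sum simp del: index_mult_mat(1))
    then show ?thesis unfolding mn by (intro bexI[of _ "0\<^sub>m n m"]) auto
  next
    case True
    then obtain i j where i: "i < m" and j: "j < n" and nz: "A $$ (i, j) \<noteq> 0" by blast
    define E where "E = mat n m (\<lambda>(r, c). if r = j \<and> c = i then inverse (A $$ (i, j)) else 0)"
    define A' where "A' = A - A * E * A"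
    have dims [simp]: "dim_row A = m" "dim_col A = n" "dim_row E = n" "dim_col E = m"
      "dim_row A' = m" "dim_col A' = n"
      by (auto simp: mn E_def A'_def)
    have AE: "(A * E) $$ (r, s) = (if s = i then A $$ (r, j) * inverse (A $$ (i, j)) else 0)"
      if "r < m" "s < m" for r s
    proof -
      have "(A * E) $$ (r, s)
          = (\<Sum>l<n. if l = j then (if s = i then A $$ (r, j) * inverse (A $$ (i, j)) else 0) else 0)"
        using that j
        by (subst mult_index_sum) (auto simp: E_def intro!: sum.cong simp del: sum.delta)
      then show ?thesis using j by simp
    qed
    \<comment> \<open>The product is the rank-one matrix built from column \<open>j\<close> and row
      \<open>i\<close> of \<open>A\<close>, scaled to agree with \<open>A\<close> in row
      \<open>i\<close>. Subtracting it clears row \<open>i\<close> and creates no new nonzero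
      row.\<close>
    have AEA: "(A * E * A) $$ (r, c) = A $$ (r, j) * inverse (A $$ (i, j)) * A $$ (i, c)"
      if "r < m" "c < n" for r c
    proof -
      have "(A * E * A) $$ (r, c)
          = (\<Sum>l<m. if l = i then A $$ (r, j) * inverse (A $$ (i, j)) * A $$ (i, c) else 0)"
        using that AE
        by (subst mult_index_sum) (auto intro!: sum.cong simp del: index_mult_mat(1) sum.delta)
      then show ?thesis using i by simp
    qed
    have A': "A' $$ (r, c) = A $$ (r, c) - A $$ (r, j) * inverse (A $$ (i, j)) * A $$ (i, c)"
      if "r < m" "c < n" for r c
      using that AEA[OF that] by (simp add: A'_def del: index_mult_mat(1))
    have "{i\<in>{..<dim_row A'}. \<exists>j<dim_col A'. A' $$ (i, j) \<noteq> 0}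
        \<subset> {i\<in>{..<dim_row A}. \<exists>j<dim_col A. A $$ (i, j) \<noteq> 0}"
    proof
      show "{i\<in>{..<dim_row A'}. \<exists>j<dim_col A'. A' $$ (i, j) \<noteq> 0}
        \<subseteq> {i\<in>{..<dim_row A}. \<exists>j<dim_col A. A $$ (i, j) \<noteq> 0}"
      proof
        fix r assume "r \<in> {i\<in>{..<dim_row A'}. \<exists>j<dim_col A'. A' $$ (i, j) \<noteq> 0}"
        then obtain c where "r < m" "c < n" "A' $$ (r, c) \<noteq> 0" by auto
        then have "A $$ (r, c) \<noteq> 0 \<or> A $$ (r, j) \<noteq> 0" using A' by auto
        then show "r \<in> {i\<in>{..<dim_row A}. \<exists>j<dim_col A. A $$ (i, j) \<noteq> 0}"
          using \<open>r < m\<close> \<open>c < n\<close> j by auto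
      qed
      have "i \<notin> {i\<in>{..<dim_row A'}. \<exists>j<dim_col A'. A' $$ (i, j) \<noteq> 0}"
        using A' i nz by auto
      moreover have "i \<in> {i\<in>{..<dim_row A}. \<exists>j<dim_col A. A $$ (i, j) \<noteq> 0}"
        using i j nz by auto
      ultimately show "{i\<in>{..<dim_row A'}. \<exists>j<dim_col A'. A' $$ (i, j) \<noteq> 0}
        \<noteq> {i\<in>{..<dim_row A}. \<exists>j<dim_col A. A $$ (i, j) \<noteq> 0}" by blast
    qed
    from less[OF psubset_card_mono[OF _ this]]
    obtain G where G: "G \<in> carrier_mat n m" "A' * G * A' = A'" by auto
    note [simp] = carrier_matD[OF G(1)]
    define L where "L = 1\<^sub>m n - E * A"
    define K where "K = 1\<^sub>m m - A * E"
    have AL: "A * L = A'"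
      by (simp add: L_def A'_def mult_minus_dim mult_assoc_dim)
    have KA: "K * A = A'"
      by (simp add: K_def A'_def minus_mult_dim mult_assoc_dim)
    have [simp]: "dim_row L = n" "dim_col L = n" "dim_row K = m" "dim_col K = m"
      by (auto simp: L_def K_def)
    \<comment> \<open>Since \<open>A * L\<close> and \<open>K * A\<close> both equal
      \<open>A'\<close>, the middle term collapses to \<open>A' * G * A' = A'\<close>, which
      restores what was subtracted from \<open>A\<close>.\<close>
    have "A * (E + L * G * K) * A = A * E * A + (A * L) * G * (K * A)"
      by (simp add: mult_add_dim add_mult_dim mult_assoc_dim)
    also have "\<dots> = A * E * A + A'"
      unfolding AL KA G(2) ..
    also have "\<dots> = A"
      by (rule eq_matI) (auto simp: A'_def simp del: index_mult_mat(1))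
    finally show ?thesis by (intro bexI[of _ "E + L * G * K"]) auto
  qed
qed

text \<open>Write H for the adjoint of \<open>A\<close> and let \<open>G\<close> be a generalized
  inverse of H A. Then K = H A G - 1 annihilates H A, so K H times its own adjoint is zero and K H =
  0. Hence B = G H works.\<close>

lemma normal_equations_solution_exists:
  fixes A :: "complex mat"
  shows "\<exists>B\<in>carrier_mat (dim_col A) (dim_row A). mat_adjoint A * A * B = mat_adjoint A"
proof -
  define H where "H = mat_adjoint A"
  define m n where "m = dim_row A" and "n = dim_col A"
  have [simp]: "dim_row A = m" "dim_col A = n" "dim_row H = n" "dim_col H = m"
    by (auto simp: m_def n_def H_def)
  obtain G where G: "G \<in> carrier_mat n n" "(H * A) * G * (H * A) = H * A"
    using generalized_inverse_exists[of "H * A"] by auto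
  note [simp] = carrier_matD[OF G(1)]
  define K where "K = H * A * G - 1\<^sub>m n"
  have [simp]: "dim_row K = n" "dim_col K = n" by (auto simp: K_def)
  have "K * (H * A) = H * A * G * (H * A) - H * A"
    by (simp add: K_def minus_mult_dim)
  then have KHA: "K * (H * A) = 0\<^sub>m n n" using G(2) by auto
  have "(K * H) * mat_adjoint (K * H) = K * (H * A) * mat_adjoint K"
    by (simp add: mat_adjoint_mult mult_assoc_dim H_def)
  also have "\<dots> = 0\<^sub>m n n" unfolding KHA by (rule left_mult_zero_mat) auto
  finally have "K * H = 0\<^sub>m n m"
    using mult_adjoint_eq_0_imp_eq_0[of "K * H"] by auto
  moreover have "K * H = H * A * (G * H) - H"
    by (simp add: K_def minus_mult_dim mult_assoc_dim)
  ultimately have 0: "H * A * (G * H) - H = 0\<^sub>m n m" by simp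
  have "H * A * (G * H) = H"
  proof (rule eq_matI)
    fix i j assume "i < dim_row H" "j < dim_col H"
    then show "(H * A * (G * H)) $$ (i, j) = H $$ (i, j)"
      using arg_cong[OF 0, of "\<lambda>M. M $$ (i, j)"] by (simp del: index_mult_mat(1))
  qed auto
  then show ?thesis
    unfolding H_def[symmetric] by (intro bexI[of _ "G * H"]) auto
qed

text \<open>Put P = A B. Multiplying the equation by the adjoint of \<open>B\<close> shows that the
  adjoint of P equals (adjoint of P) P, a Hermitian matrix, so P is Hermitian. Taking adjoints in
  the equation itself then gives P A = A: P is the orthogonal projection onto the range of
  \<open>A\<close>.\<close>

lemma normal_equations_imp_projection:
  fixes A B :: "complex mat"
  assumes B: "B \<in> carrier_mat (dim_col A) (dim_row A)"
    and eq: "mat_adjoint A * A * B = mat_adjoint A"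
  shows "mat_adjoint (A * B) = A * B" "A * B * A = A"
proof -
  note [simp] = carrier_matD[OF B]
  have "mat_adjoint (A * B) * (A * B) = mat_adjoint B * (mat_adjoint A * A * B)"
    by (simp add: mat_adjoint_mult mult_assoc_dim)
  then have *: "mat_adjoint (A * B) * (A * B) = mat_adjoint (A * B)"
    by (simp add: eq mat_adjoint_mult)
  have "mat_adjoint (mat_adjoint (A * B) * (A * B)) = mat_adjoint (A * B) * (A * B)"
    by (subst mat_adjoint_mult) auto
  then show herm: "mat_adjoint (A * B) = A * B"
    unfolding * by simp
  have "A = mat_adjoint (mat_adjoint A * (A * B))"
    using eq by (simp add: mult_assoc_dim)
  also have "\<dots> = mat_adjoint (A * B) * A"
    by (subst mat_adjoint_mult) auto
  finally show "A * B * A = A" using herm by simp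
qed

text \<open>The normal equations for \<open>A\<close> give \<open>B\<close> with A B Hermitian and A
  B A = A; those for the adjoint give \<open>C\<close> with C A Hermitian and A C A = A. The product
  C A B inherits both projections: A (C A B) = A B and (C A B) A = C A.\<close>

lemma is_pseudoinverse_exists: "\<exists>X. is_pseudoinverse A X"
proof -
  obtain B where B: "B \<in> carrier_mat (dim_col A) (dim_row A)"
    "mat_adjoint A * A * B = mat_adjoint A"
    using normal_equations_solution_exists by blast
  obtain D where D: "D \<in> carrier_mat (dim_row A) (dim_col A)"
    "mat_adjoint (mat_adjoint A) * mat_adjoint A * D = mat_adjoint (mat_adjoint A)"
    using normal_equations_solution_exists[of "mat_adjoint A"] by auto
  note [simp] = carrier_matD[OF B(1)] carrier_matD[OF D(1)]
  note AB = normal_equations_imp_projection[OF B]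
  have HD: "mat_adjoint (mat_adjoint A * D) = mat_adjoint A * D"
    "mat_adjoint A * D * mat_adjoint A = mat_adjoint A"
    using normal_equations_imp_projection[of D "mat_adjoint A"] D by auto
  define C where "C = mat_adjoint D"
  have [simp]: "dim_row C = dim_col A" "dim_col C = dim_row A" by (auto simp: C_def)
  have CA: "C * A = mat_adjoint A * D"
    using HD(1) by (simp add: C_def mat_adjoint_mult)
  have CA': "mat_adjoint (C * A) = C * A"
    unfolding CA by (rule HD(1))
  have ACA: "A * C * A = A"
    using arg_cong[OF HD(2), of mat_adjoint] by (simp add: mat_adjoint_mult C_def mult_assoc_dim)
  have AX: "A * (C * A * B) = A * B"
    using ACA by (metis mult_assoc_dim \<open>dim_row C = dim_col A\<close> \<open>dim_col C = dim_row A\<close>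
        carrier_matD[OF B(1)] index_mult_mat(2,3))
  have XA: "C * A * B * A = C * A"
    using AB(2) by (simp add: mult_assoc_dim)
  have "C * A * B * A * (C * A * B) = C * (A * C * A) * B"
    unfolding XA by (simp add: mult_assoc_dim)
  then have "is_pseudoinverse A (C * A * B)"
    unfolding is_pseudoinverse_def AX XA using AB CA' ACA B(1) by auto
  then show ?thesis by blast
qed

text \<open>From A X = (A Y)(A X), with both factors Hermitian, taking adjoints gives A X = A Y;
  symmetrically X A = Y A. Then X = X A X = Y A Y = Y.\<close>

lemma is_pseudoinverse_unique:
  assumes "is_pseudoinverse A X" "is_pseudoinverse A Y"
  shows "X = Y"
proof -
  have [simp]: "dim_row X = dim_col A" "dim_col X = dim_row A"
    "dim_row Y = dim_col A" "dim_col Y = dim_row A"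
    and X: "A * X * A = A" "X * A * X = X" "mat_adjoint (A * X) = A * X" "mat_adjoint (X * A) = X * A"
    and Y: "A * Y * A = A" "Y * A * Y = Y" "mat_adjoint (A * Y) = A * Y" "mat_adjoint (Y * A) = Y * A"
    using assms by (auto simp: is_pseudoinverse_def)
  have "A * X = (A * Y) * (A * X)"
    using Y(1) by (metis mult_assoc_dim \<open>dim_row X = dim_col A\<close> \<open>dim_row Y = dim_col A\<close>
        \<open>dim_col Y = dim_row A\<close> index_mult_mat(2,3))
  then have "mat_adjoint (A * X) = mat_adjoint (A * X) * mat_adjoint (A * Y)"
    by (subst mat_adjoint_mult[symmetric]) auto
  then have AXY: "A * X = A * Y"
    using X(1,3) Y(3) by (metis mult_assoc_dim \<open>dim_col X = dim_row A\<close> \<open>dim_row Y = dim_col A\<close>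
       index_mult_mat(2,3))
  have "X * A = (X * A) * (Y * A)"
    using Y(1) by (metis mult_assoc_dim \<open>dim_col X = dim_row A\<close> \<open>dim_row Y = dim_col A\<close>
        \<open>dim_col Y = dim_row A\<close> index_mult_mat(2,3))
  then have "mat_adjoint (X * A) = mat_adjoint (Y * A) * mat_adjoint (X * A)"
    by (subst mat_adjoint_mult[symmetric]) auto
  then have XYA: "X * A = Y * A"
    using X(1,4) Y(4) by (metis mult_assoc_dim \<open>dim_row X = dim_col A\<close> \<open>dim_col Y = dim_row A\<close>
       \<open>dim_col X = dim_row A\<close> index_mult_mat(2,3))
  have "X = X * (A * X)" using X(2) by (simp add: mult_assoc_dim)
  also have "\<dots> = Y * A * Y" unfolding AXY by (simp add: mult_assoc_dim[symmetric] XYA)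
  finally show ?thesis using Y(2) by simp
qed

lemma is_pseudoinverse_pseudoinverse: "is_pseudoinverse A (pseudoinverse A)"
  unfolding pseudoinverse_def
  by (rule theI') (use is_pseudoinverse_exists is_pseudoinverse_unique in blast)

lemma pseudoinverse_carrier [simp]:
  "pseudoinverse A \<in> carrier_mat (dim_col A) (dim_row A)"
  and mult_pseudoinverse_mult: "A * pseudoinverse A * A = A"
  using is_pseudoinverse_pseudoinverse[of A] by (auto simp: is_pseudoinverse_def)

section \<open>The Frobenius norm\<close>

lemma frob_norm_nonneg [simp]: "frob_norm A \<ge> 0"
  by (simp add: frob_norm_def sum_nonneg)

lemma frob_norm_square:
  "(frob_norm A)\<^sup>2 = (\<Sum>r<dim_row A. \<Sum>c<dim_col A. (norm (A $$ (r, c)))\<^sup>2)"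
  by (simp add: frob_norm_def sum_nonneg)

section \<open>Cauchy-Schwarz and submultiplicativity\<close>

lemma norm_sum_mult_square_le:
  fixes a b :: "'i \<Rightarrow> complex"
  shows "(norm (\<Sum>i\<in>I. a i * b i))\<^sup>2 \<le> (\<Sum>i\<in>I. (norm (a i))\<^sup>2) * (\<Sum>i\<in>I. (norm (b i))\<^sup>2)"
proof -
  have "norm (\<Sum>i\<in>I. a i * b i) \<le> (\<Sum>i\<in>I. \<bar>norm (a i)\<bar> * \<bar>norm (b i)\<bar>)"
    by (rule sum_norm_le) (simp add: norm_mult)
  also have "\<dots> \<le> L2_set (\<lambda>i. norm (a i)) I * L2_set (\<lambda>i. norm (b i)) I"
    by (rule L2_set_mult_ineq)
  finally have "(norm (\<Sum>i\<in>I. a i * b i))\<^sup>2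
      \<le> (L2_set (\<lambda>i. norm (a i)) I * L2_set (\<lambda>i. norm (b i)) I)\<^sup>2"
    by (rule power_mono) simp
  then show ?thesis
    by (simp add: power_mult_distrib L2_set_def sum_nonneg)
qed

text \<open>Cauchy-Schwarz in each row: the Frobenius norm dominates the Euclidean operator
  norm.\<close>

lemma mult_mat_vec_norm_square_le:
  fixes A :: "complex mat"
  assumes "dim_col A = dim_vec v"
  shows "(\<Sum>i<dim_row A. (norm ((A *\<^sub>v v) $ i))\<^sup>2)
    \<le> (frob_norm A)\<^sup>2 * (\<Sum>i<dim_vec v. (norm (v $ i))\<^sup>2)"
proof -
  have "(\<Sum>i<dim_row A. (norm ((A *\<^sub>v v) $ i))\<^sup>2)
      \<le> (\<Sum>i<dim_row A. (\<Sum>c<dim_col A. (norm (A $$ (i, c)))\<^sup>2) * (\<Sum>i<dim_vec v. (norm (v $ i))\<^sup>2))"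
    using assms norm_sum_mult_square_le[of "\<lambda>c. A $$ (_, c)" "\<lambda>c. v $ c" "{..<dim_vec v}"]
    by (intro sum_mono) (simp add: scalar_prod_def atLeast0LessThan)
  then show ?thesis by (simp add: frob_norm_square sum_distrib_right)
qed

lemma frob_norm_mult_square_le:
  fixes A B :: "complex mat"
  assumes "dim_col A = dim_row B"
  shows "(frob_norm (A * B))\<^sup>2 \<le> (frob_norm A)\<^sup>2 * (frob_norm B)\<^sup>2"
proof -
  have "(frob_norm (A * B))\<^sup>2
      = (\<Sum>c<dim_col B. \<Sum>r<dim_row A. (norm ((A *\<^sub>v col B c) $ r))\<^sup>2)"
    unfolding frob_norm_square by (subst sum.swap) simp
  also have "\<dots> \<le> (\<Sum>c<dim_col B. (frob_norm A)\<^sup>2 * (\<Sum>r<dim_row B. (norm (col B c $ r))\<^sup>2))"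
  proof (rule sum_mono)
    fix c
    show "(\<Sum>r<dim_row A. (norm ((A *\<^sub>v col B c) $ r))\<^sup>2)
        \<le> (frob_norm A)\<^sup>2 * (\<Sum>r<dim_row B. (norm (col B c $ r))\<^sup>2)"
      using mult_mat_vec_norm_square_le[of A "col B c"] assms by simp
  qed
  also have "\<dots> = (frob_norm A)\<^sup>2 * (frob_norm B)\<^sup>2"
    unfolding frob_norm_square[of B] sum_distrib_left by (subst (2) sum.swap) simp
  finally show ?thesis .
qed

section \<open>The squared norm as trace of the Gram matrix: isometries and Pythagoras\<close>

lemma frob_norm_square_adjoint_mult:
  fixes A :: "complex mat"
  shows "complex_of_real ((frob_norm A)\<^sup>2) = (\<Sum>c<dim_col A. (mat_adjoint A * A) $$ (c, c))"
proof -
  have "complex_of_real ((frob_norm A)\<^sup>2)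
      = (\<Sum>c<dim_col A. \<Sum>r<dim_row A. A $$ (r, c) * cnj (A $$ (r, c)))"
    unfolding frob_norm_square by (subst sum.swap) (simp only: of_real_sum complex_norm_square)
  then show ?thesis
    by (simp add: mult_index_sum mult.commute del: index_mult_mat(1))
qed

lemma frob_norm_uminus [simp]: "frob_norm (- A) = frob_norm A"
  by (simp add: frob_norm_def)

lemma frob_norm_transpose [simp]: "frob_norm (transpose_mat A) = frob_norm A"
  by (simp add: frob_norm_def) (subst sum.swap, simp)

lemma frob_norm_adjoint [simp]: "frob_norm (mat_adjoint A) = frob_norm (A :: complex mat)"
  by (simp add: frob_norm_def) (subst sum.swap, simp)

text \<open>Multiplication by \<open>U\<close> leaves the Gram matrix of \<open>A\<close>, hence its
  trace, unchanged.\<close>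

lemma frob_norm_isometry_mult:
  fixes U :: "complex mat"
  assumes "mat_adjoint U * U = 1\<^sub>m (dim_col U)" "dim_col U = dim_row A"
  shows "(frob_norm (U * A))\<^sup>2 = (frob_norm A)\<^sup>2"
proof -
  have "mat_adjoint (U * A) * (U * A) = mat_adjoint A * ((mat_adjoint U * U) * A)"
    using assms(2) by (simp add: mat_adjoint_mult mult_assoc_dim)
  also have "\<dots> = mat_adjoint A * A"
    unfolding assms(1) using assms(2) by simp
  finally have "complex_of_real ((frob_norm (U * A))\<^sup>2) = of_real ((frob_norm A)\<^sup>2)"
    unfolding frob_norm_square_adjoint_mult by simp
  then show ?thesis by (simp only: of_real_eq_iff)
qed

lemma frob_norm_mult_isometry_adjoint:
  fixes U :: "complex mat"
  assumes "mat_adjoint U * U = 1\<^sub>m (dim_col U)" "dim_col A = dim_col U"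
  shows "(frob_norm (A * mat_adjoint U))\<^sup>2 = (frob_norm A)\<^sup>2"
proof -
  have "A * mat_adjoint U = mat_adjoint (U * mat_adjoint A)"
    using assms(2) by (simp add: mat_adjoint_mult)
  then show ?thesis
    using frob_norm_isometry_mult[OF assms(1), of "mat_adjoint A"] assms(2) by simp
qed

text \<open>The two cross terms of the Gram matrix are adjoint to each other, so one vanishing
  product removes both.\<close>

lemma frob_norm_add_orthogonal_cols:
  fixes X Y :: "complex mat"
  assumes dims: "dim_row X = dim_row Y" "dim_col X = dim_col Y"
    and orth: "mat_adjoint Y * X = 0\<^sub>m (dim_col Y) (dim_col Y)"
  shows "(frob_norm (X + Y))\<^sup>2 = (frob_norm X)\<^sup>2 + (frob_norm Y)\<^sup>2"
proof -
  have adj: "mat_adjoint (X + Y) = mat_adjoint X + mat_adjoint Y"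
    using dims by (intro eq_matI) auto
  have "mat_adjoint X * Y = mat_adjoint (mat_adjoint Y * X)"
    using dims by (simp add: mat_adjoint_mult)
  then have orth': "mat_adjoint X * Y = 0\<^sub>m (dim_col Y) (dim_col Y)"
    unfolding orth by simp
  have "mat_adjoint (X + Y) * (X + Y)
      = (mat_adjoint X * X + mat_adjoint Y * X) + (mat_adjoint X * Y + mat_adjoint Y * Y)"
    using dims unfolding adj by (simp add: add_mult_dim mult_add_dim)
  also have "\<dots> = mat_adjoint X * X + mat_adjoint Y * Y"
    unfolding orth orth' using dims by (intro eq_matI) (auto simp del: index_mult_mat(1))
  finally have "complex_of_real ((frob_norm (X + Y))\<^sup>2)
      = of_real ((frob_norm X)\<^sup>2) + of_real ((frob_norm Y)\<^sup>2)"
    unfolding frob_norm_square_adjoint_mult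
    using dims by (simp add: sum.distrib del: index_mult_mat(1))
  then show ?thesis by (simp only: of_real_eq_iff of_real_add[symmetric])
qed

lemma frob_norm_add_orthogonal_rows:
  fixes X Y :: "complex mat"
  assumes dims: "dim_row X = dim_row Y" "dim_col X = dim_col Y"
    and orth: "X * mat_adjoint Y = 0\<^sub>m (dim_row Y) (dim_row Y)"
  shows "(frob_norm (X + Y))\<^sup>2 = (frob_norm X)\<^sup>2 + (frob_norm Y)\<^sup>2"
proof -
  have adj: "mat_adjoint (X + Y) = mat_adjoint X + mat_adjoint Y"
    using dims by (intro eq_matI) auto
  have "mat_adjoint (mat_adjoint Y) * mat_adjoint X = mat_adjoint (X * mat_adjoint Y)"
    using dims by (simp add: mat_adjoint_mult)
  then have "mat_adjoint (mat_adjoint Y) * mat_adjoint X = 0\<^sub>m (dim_row Y) (dim_row Y)"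
    unfolding orth by simp
  from frob_norm_add_orthogonal_cols[OF _ _ this[folded dim_mat_adjoint(2)]]
  show ?thesis using dims adj by (metis dim_mat_adjoint frob_norm_adjoint)
qed

section \<open>Block matrices and the matrix \<open>M\<^sub>S\<close>\<close>

lemma sum_blocks: "(\<Sum>c<k * m. g c) = (\<Sum>j<k. \<Sum>c<m. g (j * m + c))" for k m :: nat
proof -
  have "(\<Sum>c<k * m. g c) = (\<Sum>j<k. sum g {j * m..<j * m + m})"
    by (rule sum.nat_group[symmetric])
  also have "\<dots> = (\<Sum>j<k. \<Sum>c<m. g (j * m + c))"
  proof (rule sum.cong[OF refl])
    fix j
    show "sum g {j * m..<j * m + m} = (\<Sum>c<m. g (j * m + c))"
      using sum.shift_bounds_nat_ivl[of g 0 "j * m" m]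
      by (simp add: atLeast0LessThan add.commute[of _ "j * m"])
  qed
  finally show ?thesis .
qed

lemma mult_add_less: "j * m + c < k * m" if "j < k" "c < m" for j m c k :: nat
proof -
  have "j * m + c < Suc j * m" using that by simp
  also have "\<dots> \<le> k * m" using that by (intro mult_right_mono) auto
  finally show ?thesis .
qed

text \<open>For \<open>m = n\<close> this undoes \<open>block_row\<close>. Rectangular slices are
  allowed so that it serves the p x p blocks of \<open>A\<close> and the n x p blocks of
  \<open>B\<close> alike.\<close>

definition col_block :: "nat \<Rightarrow> nat \<Rightarrow> 'a mat \<Rightarrow> nat \<Rightarrow> 'a mat" where
  "col_block n m A j = mat n m (\<lambda>(r, c). A $$ (r, j * m + c))"

lemma col_block_dim [simp]: "dim_row (col_block n m A j) = n" "dim_col (col_block n m A j) = m"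
  by (auto simp: col_block_def)

lemma frob_norm_square_blocks:
  assumes "A \<in> carrier_mat n (k * m)"
  shows "(frob_norm A)\<^sup>2 = (\<Sum>j<k. (frob_norm (col_block n m A j))\<^sup>2)"
  using assms by (simp add: frob_norm_square sum_blocks col_block_def) (rule sum.swap)

lemma block_col_dim [simp]: "dim_row (block_col p k B) = k * p" "dim_col (block_col p k B) = p"
  by (auto simp: block_col_def)

text \<open>The entrywise form matches the sum in \<open>residual_mat\<close>, so a residual becomes
  a single product with \<open>Tt\<close>.\<close>

lemma mult_block_col_index:
  fixes A :: "'a :: comm_semiring_1 mat"
  assumes "A \<in> carrier_mat n (k * p)" "\<And>j. j < k \<Longrightarrow> B j \<in> carrier_mat p p" "r < n" "c < p"
  shows "(A * block_col p k B) $$ (r, c) = (\<Sum>j<k. (col_block n p A j * B j) $$ (r, c))"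
proof -
  have "(A * block_col p k B) $$ (r, c)
      = (\<Sum>j<k. \<Sum>i<p. A $$ (r, j * p + i) * block_col p k B $$ (j * p + i, c))"
    using assms by (subst mult_index_sum) (simp_all add: sum_blocks)
  also have "\<dots> = (\<Sum>j<k. (col_block n p A j * B j) $$ (r, c))"
  proof (rule sum.cong[OF refl])
    fix j assume "j \<in> {..<k}"
    then have j: "j < k" by simp
    show "(\<Sum>i<p. A $$ (r, j * p + i) * block_col p k B $$ (j * p + i, c))
        = (col_block n p A j * B j) $$ (r, c)"
      using assms(1,3,4) j carrier_matD[OF assms(2)[OF j]]
      by (subst mult_index_sum) (auto simp: block_col_def col_block_def mult_add_less)
  qed
  finally show ?thesis .
qed

lemma mult_col_block:
  fixes A :: "'a :: comm_semiring_1 mat"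
  assumes "A \<in> carrier_mat n (k * m)" "dim_col L = n" "j < k"
  shows "L * col_block n m A j = col_block (dim_row L) m (L * A) j"
  using assms by (intro eq_matI) (auto simp: mult_index_sum col_block_def mult_add_less
      simp del: index_mult_mat(1))

section \<open>Vectorization\<close>

lemma dim_vec_stack [simp]: "dim_vec (vec_stack A) = dim_row A * dim_col A"
  by (simp add: vec_stack_def)

lemma vec_stack_norm_square:
  "(\<Sum>i<dim_row A * dim_col A. (norm (vec_stack A $ i))\<^sup>2) = (frob_norm A)\<^sup>2"
proof -
  have "(\<Sum>i<dim_row A * dim_col A. (norm (vec_stack A $ i))\<^sup>2)
      = (\<Sum>i<dim_col A * dim_row A. (norm (A $$ (i mod dim_row A, i div dim_row A)))\<^sup>2)"
    by (rule sum.cong) (auto simp: vec_stack_def mult.commute)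
  also have "\<dots> = (frob_norm A)\<^sup>2"
    unfolding sum_blocks frob_norm_square by (subst sum.swap) simp
  finally show ?thesis .
qed

lemma vec_stack_surj:
  assumes "dim_vec x = n * m"
  shows "\<exists>A\<in>carrier_mat n m. vec_stack A = x"
proof (rule bexI)
  show "vec_stack (mat n m (\<lambda>(r, c). x $ (c * n + r))) = x"
  proof (rule eq_vecI)
    fix i assume "i < dim_vec x"
    then have i: "i < n * m" using assms by simp
    then have "i mod n < n" "i div n < m"
      by (cases "n = 0"; simp add: less_mult_imp_div_less mult.commute)+
    with i show "vec_stack (mat n m (\<lambda>(r, c). x $ (c * n + r))) $ i = x $ i"
      by (simp add: vec_stack_def)
  qed (simp add: assms)
qed simp

lemma vec_stack_inj:
  assumes "A \<in> carrier_mat n m" "B \<in> carrier_mat n m" "vec_stack A = vec_stack B"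
  shows "A = B"
proof (rule eq_matI)
  fix r c assume rc: "r < dim_row B" "c < dim_col B"
  then have "c * n + r < m * n" using assms by (intro mult_add_less) auto
  then show "A $$ (r, c) = B $$ (r, c)"
    using arg_cong[OF assms(3), of "\<lambda>v. v $ (c * n + r)"] assms(1,2) rc
    by (simp add: vec_stack_def mult.commute)
qed (use assms in auto)

text \<open>The case X = I of the identity vec(X A B) = (B^T \<otimes> X) vec(A).\<close>

lemma kronecker_one_mult_vec_stack:
  fixes A B :: "'a :: comm_semiring_1 mat"
  assumes A: "A \<in> carrier_mat p q" and B: "B \<in> carrier_mat q m"
  shows "kronecker_prod (transpose_mat B) (1\<^sub>m p) *\<^sub>v vec_stack A = vec_stack (A * B)"
proof (rule eq_vecI)
  fix i assume "i < dim_vec (vec_stack (A * B))"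
  then have i: "i < p * m" using A B by simp
  then have im: "i mod p < p" "i div p < m"
    by (cases "p = 0"; simp add: less_mult_imp_div_less mult.commute)+
  have "(kronecker_prod (transpose_mat B) (1\<^sub>m p) *\<^sub>v vec_stack A) $ i
      = (\<Sum>c<q * p. transpose_mat B $$ (i div p, c div p) * 1\<^sub>m p $$ (i mod p, c mod p)
          * A $$ (c mod p, c div p))"
    using A B i
    by (auto simp: kronecker_prod_def scalar_prod_def vec_stack_def mult.commute atLeast0LessThan
        intro!: sum.cong)
  \<comment> \<open>The column index splits into a block number and a position in the block; the
    identity factor keeps only position \<open>i mod p\<close>.\<close>
  also have "\<dots> = (\<Sum>c<q. \<Sum>b<p. if b = i mod p then A $$ (i mod p, c) * B $$ (c, i div p) else 0)"
    unfolding sum_blocks using B im by (intro sum.cong refl) (auto simp: mult.commute)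
  also have "\<dots> = (A * B) $$ (i mod p, i div p)"
    using A B im by (subst mult_index_sum) auto
  also have "\<dots> = vec_stack (A * B) $ i"
    using A B i by (simp add: vec_stack_def del: index_mult_mat(1))
  finally show "(kronecker_prod (transpose_mat B) (1\<^sub>m p) *\<^sub>v vec_stack A) $ i
    = vec_stack (A * B) $ i" .
qed (use A B in \<open>simp add: kronecker_prod_def mult.commute\<close>)

section \<open>The action of \<open>M_S\<close> on vectorized block rows\<close>

lemma diag_block_mat_replicate:
  fixes D :: "'a :: zero mat"
  assumes D: "D \<in> carrier_mat d d"
  shows "diag_block_mat (replicate k D) = mat (k * d) (k * d)
    (\<lambda>(r, c). if r div d = c div d then D $$ (r mod d, c mod d) else 0)"
proof (induction k)
  case 0
  show ?case by (intro eq_matI) auto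
next
  case (Suc k)
  note [simp] = carrier_matD[OF D]
  have "four_block_mat D (0\<^sub>m d (k * d)) (0\<^sub>m (k * d) d)
     (mat (k * d) (k * d) (\<lambda>(r, c). if r div d = c div d then D $$ (r mod d, c mod d) else 0)) =
    mat (d + k * d) (d + k * d) (\<lambda>(r, c). if r div d = c div d then D $$ (r mod d, c mod d) else 0)"
  proof (rule eq_matI, goal_cases)
    case (1 i j)
    then have d: "d > 0" by (cases d) auto
    have ij: "i < d + k * d" "j < d + k * d" using 1 by simp_all
    \<comment> \<open>Dropping the leading block lowers the block number by one and keeps the
      position inside the block.\<close>
    have div: "l div d = (if l < d then 0 else Suc ((l - d) div d))"
      and mod: "l mod d = (if l < d then l else (l - d) mod d)" for l
      using d by (simp_all add: le_div_geq le_mod_geq)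
    show ?case using ij
      by (cases "i < d"; cases "j < d") (simp_all add: div[of i] div[of j] mod[of i] mod[of j])
  qed simp_all
  then show ?case
    by (simp add: Suc Let_def)
qed
lemma diag_block_mat_replicate_mult_vec:
  fixes D :: "'a :: comm_ring_1 mat"
  assumes D: "D \<in> carrier_mat d d" and x: "x \<in> carrier_vec (k * d)" and i: "i < k * d"
  shows "(diag_block_mat (replicate k D) *\<^sub>v x) $ i
    = (D *\<^sub>v vec d (\<lambda>l. x $ (i div d * d + l))) $ (i mod d)"
proof -
  have d: "d > 0" "i div d < k" "i mod d < d"
    using i by (cases d; simp add: less_mult_imp_div_less)+
  have "(diag_block_mat (replicate k D) *\<^sub>v x) $ i
      = (\<Sum>j<k. \<Sum>c<d. (if i div d = j then D $$ (i mod d, c) else 0) * x $ (j * d + c))"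
    using i x unfolding diag_block_mat_replicate[OF D]
    by (auto simp: scalar_prod_def atLeast0LessThan sum_blocks intro!: sum.cong)
  also have "\<dots> = (\<Sum>j<k. if j = i div d then \<Sum>c<d. D $$ (i mod d, c) * x $ (i div d * d + c) else 0)"
    by (rule sum.cong) auto
  also have "\<dots> = (\<Sum>c<d. D $$ (i mod d, c) * x $ (i div d * d + c))"
    using d by simp
  also have "\<dots> = (D *\<^sub>v vec d (\<lambda>l. x $ (i div d * d + l))) $ (i mod d)"
    using d D by (simp add: scalar_prod_def atLeast0LessThan)
  finally show ?thesis .
qed

text \<open>Stacking goes column by column, so \<open>p\<close> consecutive columns form one
  contiguous segment of length \<open>p * p\<close>.\<close>

lemma vec_stack_col_block:
  assumes A: "A \<in> carrier_mat p (k * p)" and j: "j < k"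
  shows "vec (p * p) (\<lambda>l. vec_stack A $ (j * (p * p) + l)) = vec_stack (col_block p p A j)"
proof (rule eq_vecI)
  fix l assume "l < dim_vec (vec_stack (col_block p p A j))"
  then have l: "l < p * p" by simp
  then have p: "p > 0" by (cases p) auto
  \<comment> \<open>In this form division by \<open>p\<close> yields the column number
    \<open>j * p + l div p\<close> in the full matrix.\<close>
  have "j * (p * p) + l = p * (j * p) + l" by simp
  then have "(j * (p * p) + l) div p = j * p + l div p" "(j * (p * p) + l) mod p = l mod p"
    using p by (metis div_mult_self4 add.commute less_not_refl3, metis mod_mult_self4)
  moreover have "j * (p * p) + l < k * (p * p)" using j l by (rule mult_add_less)
  moreover have "l div p < p" using l by (simp add: less_mult_imp_div_less)
  ultimately show "vec (p * p) (\<lambda>l. vec_stack A $ (j * (p * p) + l)) $ l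
      = vec_stack (col_block p p A j) $ l"
    using A l p by (simp add: vec_stack_def col_block_def mult_ac)
qed simp

text \<open>The upper part carries the linear equation and the lower part the defect of symmetry of
  each block; the latter vanishes exactly when all blocks are symmetric.\<close>

lemma M_S_mult_vec_stack:
  assumes A: "A \<in> carrier_mat p (k * p)" and Tt: "Tt \<in> carrier_mat (k * p) p"
  shows "M_S p k Tt *\<^sub>v vec_stack A = vec_stack (A * Tt) @\<^sub>v
    vec (k * (p * p)) (\<lambda>i. let A\<^sub>j = col_block p p A (i div (p * p))
      in (vec_stack (transpose_mat A\<^sub>j) - vec_stack A\<^sub>j) $ (i mod (p * p)))"
proof -
  define D :: "complex mat" where "D = commutation_mat p - 1\<^sub>m (p * p)"
  have D: "D \<in> carrier_mat (p * p) (p * p)" by (rule carrier_matI) (auto simp: D_def commutation_mat_def)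
  have x: "vec_stack A \<in> carrier_vec (k * (p * p))"
    using A by (intro carrier_vecI) (simp add: mult_ac)
  have "M_S p k Tt *\<^sub>v vec_stack A
    = (kronecker_prod (transpose_mat Tt) (1\<^sub>m p) *\<^sub>v vec_stack A) @\<^sub>v
      (diag_block_mat (replicate k D) *\<^sub>v vec_stack A)"
    unfolding M_S_def D_def[symmetric]
  proof (rule mat_mult_append)
    show "kronecker_prod (transpose_mat Tt) (1\<^sub>m p) \<in> carrier_mat (p * p) (k * (p * p))"
      using Tt by (intro carrier_matI) (auto simp: kronecker_prod_def)
    show "diag_block_mat (replicate k D) \<in> carrier_mat (k * (p * p)) (k * (p * p))"
      unfolding diag_block_mat_replicate[OF D] by simp
  qed (rule x)
  moreover have "diag_block_mat (replicate k D) *\<^sub>v vec_stack A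
    = vec (k * (p * p)) (\<lambda>i. let A\<^sub>j = col_block p p A (i div (p * p))
      in (vec_stack (transpose_mat A\<^sub>j) - vec_stack A\<^sub>j) $ (i mod (p * p)))"
  proof (rule eq_vecI, goal_cases)
    case (1 i)
    then have i: "i < k * (p * p)" by simp
    define j where "j = i div (p * p)"
    define A\<^sub>j where "A\<^sub>j = col_block p p A j"
    have j: "j < k" using i by (simp add: j_def less_mult_imp_div_less)
    have Aj: "A\<^sub>j \<in> carrier_mat p p" by (auto simp: A\<^sub>j_def)
    have "(diag_block_mat (replicate k D) *\<^sub>v vec_stack A) $ i
        = (D *\<^sub>v vec_stack A\<^sub>j) $ (i mod (p * p))"
      using diag_block_mat_replicate_mult_vec[OF D x i] vec_stack_col_block[OF A j]
      by (simp add: A\<^sub>j_def j_def)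
    also have "D *\<^sub>v vec_stack A\<^sub>j
        = commutation_mat p *\<^sub>v vec_stack A\<^sub>j - 1\<^sub>m (p * p) *\<^sub>v vec_stack A\<^sub>j"
      unfolding D_def using Aj
      by (intro minus_mult_distrib_mat_vec)
        (auto simp: commutation_mat_def intro!: carrier_vecI)
    also have "\<dots> = vec_stack (transpose_mat A\<^sub>j) - vec_stack A\<^sub>j"
      using Aj by (simp add: commutation_mat_vec_stack one_mult_mat_vec[OF carrier_vecI])
    finally show ?case using i by (simp add: Let_def A\<^sub>j_def j_def)
  qed (simp add: diag_block_mat_replicate[OF D])
  ultimately show ?thesis
    by (simp add: kronecker_one_mult_vec_stack[OF A Tt])
qed

lemma M_S_dim:
  assumes Tt: "Tt \<in> carrier_mat (k * p) p"
  shows "M_S p k Tt \<in> carrier_mat (p * p + k * (p * p)) (k * (p * p))"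
proof -
  have D: "(commutation_mat p - 1\<^sub>m (p * p) :: complex mat) \<in> carrier_mat (p * p) (p * p)"
    by (rule carrier_matI) (auto simp: commutation_mat_def)
  show ?thesis
    unfolding M_S_def
  proof (rule carrier_append_rows)
    show "kronecker_prod (transpose_mat Tt) (1\<^sub>m p) \<in> carrier_mat (p * p) (k * (p * p))"
      using Tt by (intro carrier_matI) (auto simp: kronecker_prod_def)
  qed (simp add: diag_block_mat_replicate[OF D])
qed

text \<open>The witness is the minimum norm solution of \<open>M\<^sub>S vec(A) = M\<^sub>S vec(A\<^sub>0)\<close>;
  the zero lower part of the right-hand side forces its blocks to be symmetric.\<close>

lemma symmetric_blocks_solution:
  assumes Tt: "Tt \<in> carrier_mat (k * p) p"
    and A0: "A0 \<in> carrier_mat p (k * p)"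
    and sym: "\<And>j. j < k \<Longrightarrow> transpose_mat (col_block p p A0 j) = col_block p p A0 j"
  shows "\<exists>A\<in>carrier_mat p (k * p). A * Tt = A0 * Tt \<and>
    (\<forall>j<k. transpose_mat (col_block p p A j) = col_block p p A j) \<and>
    (frob_norm A)\<^sup>2 \<le> (frob_norm (pseudoinverse (M_S p k Tt)))\<^sup>2 * (frob_norm (A0 * Tt))\<^sup>2"
proof -
  let ?M = "M_S p k Tt"
  note [simp] = carrier_matD[OF Tt] carrier_matD[OF A0] carrier_matD[OF M_S_dim[OF Tt]]
  \<comment> \<open>By construction \<open>b\<close> lies in the range of \<open>?M\<close>, so
    \<open>?M * pseudoinverse ?M\<close> fixes it and \<open>x\<close> solves the system.\<close>
  define b where "b = ?M *\<^sub>v vec_stack A0"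
  define x where "x = pseudoinverse ?M *\<^sub>v b"
  have pc: "pseudoinverse ?M \<in> carrier_mat (k * (p * p)) (p * p + k * (p * p))"
    using pseudoinverse_carrier[of ?M] by simp
  have dx: "dim_vec x = p * (k * p)" using pc by (simp add: x_def mult.left_commute)
  obtain A where A: "A \<in> carrier_mat p (k * p)" "vec_stack A = x"
    using vec_stack_surj[OF dx] by (elim bexE)
  have v0: "vec_stack A0 \<in> carrier_vec (k * (p * p))"
    by (intro carrier_vecI) (simp add: mult.left_commute)
  have "(?M * pseudoinverse ?M * ?M) *\<^sub>v vec_stack A0 = (?M * pseudoinverse ?M) *\<^sub>v b"
    unfolding b_def
    by (rule assoc_mult_mat_vec[OF mult_carrier_mat[OF M_S_dim[OF Tt] pc] M_S_dim[OF Tt] v0])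
  also have "\<dots> = ?M *\<^sub>v x"
    unfolding x_def
    by (rule assoc_mult_mat_vec[OF M_S_dim[OF Tt] pc]) (rule carrier_vecI, simp add: b_def)
  finally have "?M *\<^sub>v x = (?M * pseudoinverse ?M * ?M) *\<^sub>v vec_stack A0" ..
  then have Mx: "?M *\<^sub>v vec_stack A = b"
    unfolding mult_pseudoinverse_mult A(2) b_def .
  \<comment> \<open>Symmetry of the blocks of \<open>A0\<close> makes the lower part zero, so the
    norm of \<open>b\<close> is that of \<open>A0 * Tt\<close> alone.\<close>
  have b: "b = vec_stack (A0 * Tt) @\<^sub>v 0\<^sub>v (k * (p * p))"
    unfolding b_def M_S_mult_vec_stack[OF A0 Tt]
  proof (intro arg_cong2[where f = append_vec] refl eq_vecI, goal_cases)
    case (1 i)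
    then have "i div (p * p) < k" "i mod (p * p) < p * p"
      by (cases "p = 0"; simp add: less_mult_imp_div_less)+
    then show ?case using 1 sym by (simp add: Let_def)
  qed simp
  have eq: "vec_stack (A * Tt) = vec_stack (A0 * Tt)"
    "vec (k * (p * p)) (\<lambda>i. let A\<^sub>j = col_block p p A (i div (p * p))
      in (vec_stack (transpose_mat A\<^sub>j) - vec_stack A\<^sub>j) $ (i mod (p * p))) = 0\<^sub>v (k * (p * p))"
  proof -
    have "vec_stack (A * Tt) \<in> carrier_vec (p * p)" "vec_stack (A0 * Tt) \<in> carrier_vec (p * p)"
      using A(1) by (intro carrier_vecI; simp)+
    note append_eq = append_vec_eq[OF this]
    note Mx[unfolded b M_S_mult_vec_stack[OF A(1) Tt] append_eq]
    then show "vec_stack (A * Tt) = vec_stack (A0 * Tt)"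
      "vec (k * (p * p)) (\<lambda>i. let A\<^sub>j = col_block p p A (i div (p * p))
        in (vec_stack (transpose_mat A\<^sub>j) - vec_stack A\<^sub>j) $ (i mod (p * p))) = 0\<^sub>v (k * (p * p))"
      by (rule conjunct1, rule conjunct2)
  qed
  have "A * Tt = A0 * Tt"
    using eq(1) A(1) by (intro vec_stack_inj[of _ p p]) auto
  moreover have "transpose_mat (col_block p p A j) = col_block p p A j" if j: "j < k" for j
  proof (rule vec_stack_inj[of _ p p])
    show "vec_stack (transpose_mat (col_block p p A j)) = vec_stack (col_block p p A j)"
    proof (rule eq_vecI)
      fix l assume "l < dim_vec (vec_stack (col_block p p A j))"
      then have l: "l < p * p" by simp
      then have jl: "j * (p * p) + l < k * (p * p)" using j by (intro mult_add_less)
      have "(j * m + l) div m = j" "(j * m + l) mod m = l" if "l < m" for m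
        using that by auto
      note dm = this[OF l]
      show "vec_stack (transpose_mat (col_block p p A j)) $ l = vec_stack (col_block p p A j) $ l"
        using arg_cong[OF eq(2), of "\<lambda>v. v $ (j * (p * p) + l)"] jl l
        by (simp add: Let_def dm)
    qed simp
  qed auto
  moreover have "(frob_norm A)\<^sup>2 \<le> (frob_norm (pseudoinverse ?M))\<^sup>2 * (frob_norm (A0 * Tt))\<^sup>2"
  proof -
    have "(frob_norm A)\<^sup>2 = (\<Sum>i<dim_row (pseudoinverse ?M). (norm ((pseudoinverse ?M *\<^sub>v b) $ i))\<^sup>2)"
      unfolding vec_stack_norm_square[symmetric] A(2) using A(1) pc
      by (simp add: x_def mult.left_commute[of p k p])
    also have "\<dots> \<le> (frob_norm (pseudoinverse ?M))\<^sup>2 * (\<Sum>i<dim_vec b. (norm (b $ i))\<^sup>2)"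
      using pc by (intro mult_mat_vec_norm_square_le) (simp add: b_def)
    also have "(\<Sum>i<dim_vec b. (norm (b $ i))\<^sup>2) = (\<Sum>i<p * p. (norm (vec_stack (A0 * Tt) $ i))\<^sup>2)"
      unfolding b by (rule sum.mono_neutral_cong_right) auto
    also have "\<dots> = (frob_norm (A0 * Tt))\<^sup>2"
      using vec_stack_norm_square[of "A0 * Tt"] by simp
    finally show ?thesis .
  qed
  ultimately show ?thesis using A(1) by blast
qed

section \<open>Structured perturbations\<close>

lemma fun_Lambda_dim [simp]:
  "dim_row (fun_Lambda p f lam j) = p" "dim_col (fun_Lambda p f lam j) = p"
  by (auto simp: fun_Lambda_def mat_diag_def)

lemma mult_fun_Lambda_index:
  assumes "G \<in> carrier_mat n n" "V \<in> carrier_mat n p" "r < n" "i < p"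
  shows "(G * V * fun_Lambda p f lam j) $$ (r, i) = (\<Sum>s<n. G $$ (r, s) * V $$ (s, i)) * f j (lam i)"
proof -
  have "G * V \<in> carrier_mat n p" using assms by simp
  from mat_diag_mult_right[OF this]
  have "(G * V * fun_Lambda p f lam j) $$ (r, i) = (G * V) $$ (r, i) * f j (lam i)"
    using assms by (simp add: fun_Lambda_def)
  also have "(G * V) $$ (r, i) = (\<Sum>s<n. G $$ (r, s) * V $$ (s, i))"
    using assms by (subst mult_index_sum) auto
  finally show ?thesis .
qed

text \<open>The complex conjugate of a complex symmetric solution solves the equation as well, because
  conjugation merely permutes the eigenpairs; hence so does their average.\<close>

lemma admissible_perturbation_Re:
  fixes F :: "nat \<Rightarrow> real mat"
  assumes F: "\<And>j. j < k \<Longrightarrow> F j \<in> carrier_mat n n"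
    and V: "V \<in> carrier_mat n p"
    and cc: "conjugation_closed p k f V lam"
    and G: "\<And>j. j < k \<Longrightarrow> G j \<in> carrier_mat n n"
    and sym: "\<And>j. j < k \<Longrightarrow> transpose_mat (G j) = G j"
    and sol: "\<And>r i. r < n \<Longrightarrow> i < p \<Longrightarrow>
      (\<Sum>j<k. (G j * V * fun_Lambda p f lam j) $$ (r, i)) = - residual_mat n p k f F V lam $$ (r, i)"
  shows "admissible_perturbation n p k f F V lam (\<lambda>j. map_mat Re (G j))"
proof -
  define g where "g r i = (\<Sum>j<k. (\<Sum>s<n. G j $$ (r, s) * V $$ (s, i)) * f j (lam i))" for r i
  define h where "h r i = (\<Sum>j<k. (\<Sum>s<n. of_real (F j $$ (r, s)) * V $$ (s, i)) * f j (lam i))"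
    for r i
  have h: "residual_mat n p k f F V lam $$ (r, i) = h r i" if "r < n" "i < p" for r i
  proof -
    have "residual_mat n p k f F V lam $$ (r, i)
        = (\<Sum>j<k. (map_mat complex_of_real (F j) * V * fun_Lambda p f lam j) $$ (r, i))"
      using that by (simp add: residual_mat_def)
    also have "\<dots> = h r i"
      unfolding h_def
    proof (rule sum.cong[OF refl])
      fix j assume "j \<in> {..<k}"
      then have "F j \<in> carrier_mat n n" using F by auto
      then show "(map_mat complex_of_real (F j) * V * fun_Lambda p f lam j) $$ (r, i)
          = (\<Sum>s<n. of_real (F j $$ (r, s)) * V $$ (s, i)) * f j (lam i)"
        using that V by (subst mult_fun_Lambda_index) auto
    qed
    finally show ?thesis .
  qed
  have g: "g r i = - h r i" if "r < n" "i < p" for r i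
  proof -
    have "g r i = (\<Sum>j<k. (G j * V * fun_Lambda p f lam j) $$ (r, i))"
      unfolding g_def using mult_fun_Lambda_index[OF G V that] by (intro sum.cong) simp_all
    then show ?thesis using sol[OF that] h[OF that] by simp
  qed
  \<comment> \<open>Column \<open>i\<close> of the equation for the conjugate of \<open>G\<close> is
    the conjugate of column \<open>i'\<close> of the equation for \<open>G\<close>, where
    \<open>i'\<close> is the index of the conjugate eigenpair. The right-hand side transforms in the
    same way because the \<open>F j\<close> are real.\<close>
  have gc: "(\<Sum>j<k. (\<Sum>s<n. cnj (G j $$ (r, s)) * V $$ (s, i)) * f j (lam i)) = - h r i"
    if ri: "r < n" "i < p" for r i
  proof -
    obtain i' where i': "i' < p" "col V i' = conjugate (col V i)"
      "\<And>j. j < k \<Longrightarrow> f j (lam i') = cnj (f j (lam i))"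
      using cc ri by (auto simp: conjugation_closed_def)
    have V': "V $$ (s, i') = cnj (V $$ (s, i))" if "s < n" for s
      using arg_cong[OF i'(2), of "\<lambda>v. v $ s"] that i'(1) ri V by simp
    have "(\<Sum>j<k. (\<Sum>s<n. cnj (G j $$ (r, s)) * V $$ (s, i)) * f j (lam i)) = cnj (g r i')"
      using V' i'(3) by (simp add: g_def)
    also have "\<dots> = - cnj (h r i')"
      using g ri(1) i'(1) by simp
    also have "cnj (h r i') = h r i"
      using V' i'(3) by (simp add: h_def)
    finally show ?thesis .
  qed
  have "residual_mat n p k f (\<lambda>j. F j + map_mat Re (G j)) V lam = 0\<^sub>m n p"
  proof (rule eq_matI)
    fix r i assume "r < dim_row (0\<^sub>m n p :: complex mat)" "i < dim_col (0\<^sub>m n p :: complex mat)"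
    then have ri: "r < n" "i < p" by auto
    have "residual_mat n p k f (\<lambda>j. F j + map_mat Re (G j)) V lam $$ (r, i)
        = (\<Sum>j<k. (map_mat complex_of_real (F j + map_mat Re (G j)) * V * fun_Lambda p f lam j) $$ (r, i))"
      using ri by (simp add: residual_mat_def)
    also have "\<dots> = (\<Sum>j<k. (\<Sum>s<n. (of_real (F j $$ (r, s)) * V $$ (s, i)
        + G j $$ (r, s) * V $$ (s, i) / 2 + cnj (G j $$ (r, s)) * V $$ (s, i) / 2)) * f j (lam i))"
    proof (rule sum.cong[OF refl])
      fix j assume "j \<in> {..<k}"
      then have FG: "F j \<in> carrier_mat n n" "G j \<in> carrier_mat n n" using F G by auto
      have Re: "complex_of_real (Re z) = z / 2 + cnj z / 2" for z
        by (simp add: complex_eq_iff)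
      show "(map_mat complex_of_real (F j + map_mat Re (G j)) * V * fun_Lambda p f lam j) $$ (r, i)
        = (\<Sum>s<n. (of_real (F j $$ (r, s)) * V $$ (s, i)
        + G j $$ (r, s) * V $$ (s, i) / 2 + cnj (G j $$ (r, s)) * V $$ (s, i) / 2)) * f j (lam i)"
        using FG V ri
        by (subst mult_fun_Lambda_index) (auto simp: Re algebra_simps intro!: sum.cong)
    qed
    also have "\<dots> = h r i + g r i / 2
        + (\<Sum>j<k. (\<Sum>s<n. cnj (G j $$ (r, s)) * V $$ (s, i)) * f j (lam i)) / 2"
      unfolding g_def h_def
      by (simp add: sum.distrib distrib_right sum_divide_distrib[symmetric])
    also have "\<dots> = 0"
      unfolding gc[OF ri] g[OF ri] by simp
    finally show "residual_mat n p k f (\<lambda>j. F j + map_mat Re (G j)) V lam $$ (r, i)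
        = 0\<^sub>m n p $$ (r, i)"
      using ri by simp
  qed (auto simp: residual_mat_def)
  then show ?thesis
    unfolding admissible_perturbation_def using G sym by (simp add: map_mat_transpose)
qed

text \<open>The infimum lies between 0 and the norm of the given perturbation, so the inequality
  survives squaring; the squared norm of the block row then splits over its blocks.\<close>

lemma structured_backward_error_square_le:
  assumes "admissible_perturbation n p k f F V lam dF"
  shows "(structured_backward_error n p k f F V lam)\<^sup>2 \<le> (\<Sum>j<k. (frob_norm (dF j))\<^sup>2)"
proof -
  let ?S = "{frob_norm (block_row n k dF) | dF. admissible_perturbation n p k f F V lam dF}"
  have mem: "frob_norm (block_row n k dF) \<in> ?S" using assms by blast
  have "Inf ?S \<le> frob_norm (block_row n k dF)"
    using mem by (rule cInf_lower) (auto intro!: bdd_belowI[of _ 0])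
  moreover have "Inf ?S \<ge> 0"
    using mem by (intro cInf_greatest) auto
  ultimately have "(structured_backward_error n p k f F V lam)\<^sup>2 \<le> (frob_norm (block_row n k dF))\<^sup>2"
    unfolding structured_backward_error_def by (rule power_mono)
  also have "\<dots> = (\<Sum>j<k. (frob_norm (col_block n n (block_row n k dF) j))\<^sup>2)"
    by (rule frob_norm_square_blocks) (simp add: block_row_def)
  also have "\<dots> = (\<Sum>j<k. (frob_norm (dF j))\<^sup>2)"
  proof (rule sum.cong[OF refl])
    fix j assume "j \<in> {..<k}"
    then have "j < k" "dF j \<in> carrier_mat n n"
      using assms by (auto simp: admissible_perturbation_def)
    then have "col_block n n (block_row n k dF) j = dF j"
      by (intro eq_matI) (auto simp: col_block_def block_row_def mult_add_less)
    then show "(frob_norm (col_block n n (block_row n k dF) j))\<^sup>2 = (frob_norm (dF j))\<^sup>2" by simp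
  qed
  finally show ?thesis .
qed

lemma frob_norm_Re_square_le: "(frob_norm (map_mat Re A))\<^sup>2 \<le> (frob_norm A)\<^sup>2"
  unfolding frob_norm_square
  by (simp, intro sum_mono) (metis abs_Re_le_cmod abs_norm_cancel power2_abs power2_le_iff_abs_le norm_ge_zero)

text \<open>With \<open>Q\<close> a unitary completion of \<open>Q\<^sub>1\<close>, this is the
  matrix \<open>cnj Q [A, C\<^sup>T; C, 0] Q\<^sup>*\<close>, where \<open>B = cnj Q\<^sub>2 C\<close>.\<close>

definition bordered :: "complex mat \<Rightarrow> complex mat \<Rightarrow> complex mat \<Rightarrow> complex mat" where
  "bordered Q A B = transpose_mat (mat_adjoint Q) * (A * mat_adjoint Q + transpose_mat B)
    + B * mat_adjoint Q"

section \<open>Symmetry, action and norm of the bordered matrix\<close>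

context
  fixes Q A B :: "complex mat" and n p :: nat
  assumes Q: "Q \<in> carrier_mat n p" "mat_adjoint Q * Q = 1\<^sub>m p"
    and A: "A \<in> carrier_mat p p" "transpose_mat A = A"
    and B: "B \<in> carrier_mat n p" "transpose_mat Q * B = 0\<^sub>m p p"
begin

private lemma dims [simp]:
  "dim_row Q = n" "dim_col Q = p" "dim_row A = p" "dim_col A = p" "dim_row B = n" "dim_col B = p"
  using Q A B by auto

lemma bordered_carrier: "bordered Q A B \<in> carrier_mat n n"
  by (rule carrier_matI) (auto simp: bordered_def)

text \<open>Transposition exchanges the two terms containing \<open>B\<close> and fixes the one
  containing \<open>A\<close>. This is symmetry without conjugation, hence the conjugate of
  \<open>Q\<close> on the left and the adjoint on the right.\<close>

lemma bordered_symmetric: "transpose_mat (bordered Q A B) = bordered Q A B"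
proof -
  let ?Qh = "mat_adjoint Q"
  have "transpose_mat (bordered Q A B)
    = (transpose_mat (A * ?Qh) + B) * ?Qh + transpose_mat ?Qh * transpose_mat B"
    unfolding bordered_def
    by (simp add: transpose_add[of _ n n] transpose_add[of _ p n] transpose_mult[of _ n p _ n]
        carrier_matI)
  also have "transpose_mat (A * ?Qh) = transpose_mat ?Qh * A"
    by (subst transpose_mult[of _ p p _ n]) (auto simp: A(2) intro: carrier_matI)
  also have "(transpose_mat ?Qh * A + B) * ?Qh + transpose_mat ?Qh * transpose_mat B
      = transpose_mat ?Qh * (A * ?Qh) + B * ?Qh + transpose_mat ?Qh * transpose_mat B"
    by (simp add: add_mult_dim mult_assoc_dim)
  also have "\<dots> = transpose_mat ?Qh * (A * ?Qh) + transpose_mat ?Qh * transpose_mat B + B * ?Qh"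
    by (intro eq_matI) (simp_all del: index_mult_mat(1))
  also have "\<dots> = bordered Q A B"
    by (simp add: bordered_def mult_add_dim)
  finally show ?thesis .
qed

text \<open>The term with \<open>transpose_mat B\<close> dies because
  \<open>transpose_mat B * Q\<close> is the transpose of \<open>transpose_mat Q * B\<close>; in the
  others the adjoint of \<open>Q\<close> cancels \<open>Q\<close>.\<close>

lemma bordered_mult: "bordered Q A B * Q = transpose_mat (mat_adjoint Q) * A + B"
proof -
  have "transpose_mat B * Q = transpose_mat (transpose_mat Q * B)"
    by (subst transpose_mult[of _ p n _ p]) (auto intro: carrier_matI)
  then have BQ: "transpose_mat B * Q = 0\<^sub>m p p" unfolding B(2) by simp
  have "bordered Q A B * Q = transpose_mat (mat_adjoint Q) * (A * (mat_adjoint Q * Q)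
      + transpose_mat B * Q) + B * (mat_adjoint Q * Q)"
    by (simp add: bordered_def add_mult_dim mult_assoc_dim)
  also have "A * (mat_adjoint Q * Q) + transpose_mat B * Q = A"
    unfolding BQ Q(2) by (intro eq_matI) auto
  finally show ?thesis by (simp add: Q(2))
qed

text \<open>Pythagoras is applied twice: first the columns of \<open>B\<close> are orthogonal to
  those of the conjugate of \<open>Q\<close>, then the rows of \<open>transpose_mat B\<close> to
  those of the adjoint of \<open>Q\<close>. \<open>B\<close> enters two terms, whence the factor
  2.\<close>

lemma bordered_frob_norm: "(frob_norm (bordered Q A B))\<^sup>2 = (frob_norm A)\<^sup>2 + 2 * (frob_norm B)\<^sup>2"
proof -
  let ?Qh = "mat_adjoint Q" and ?Qc = "transpose_mat (mat_adjoint Q)"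
  let ?X = "A * ?Qh + transpose_mat B"
  have adjc: "mat_adjoint (transpose_mat Q) = ?Qc" "mat_adjoint ?Qc = transpose_mat Q"
    by (simp_all add: mat_adjoint_transpose)
  have "mat_adjoint (transpose_mat Q * B) = mat_adjoint B * ?Qc"
    by (simp add: mat_adjoint_mult adjc)
  then have BQc: "mat_adjoint B * ?Qc = 0\<^sub>m p p" unfolding B(2) by simp
  have QQ: "transpose_mat Q * ?Qc = 1\<^sub>m p"
    using arg_cong[OF Q(2), of transpose_mat] by (subst (asm) transpose_mult[of _ p n _ p]) (auto intro: carrier_matI)
  have isoQ: "mat_adjoint Q * Q = 1\<^sub>m (dim_col Q)" using Q by simp
  have "mat_adjoint (B * ?Qh) * (?Qc * ?X) = Q * ((mat_adjoint B * ?Qc) * ?X)"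
    by (simp add: mat_adjoint_mult mult_assoc_dim)
  also have "\<dots> = 0\<^sub>m n n"
    unfolding BQc by (intro eq_matI) (auto simp: mult_index_sum simp del: index_mult_mat(1))
  finally have "(frob_norm (bordered Q A B))\<^sup>2 = (frob_norm (?Qc * ?X))\<^sup>2 + (frob_norm (B * ?Qh))\<^sup>2"
    unfolding bordered_def by (intro frob_norm_add_orthogonal_cols) auto
  also have "(frob_norm (B * ?Qh))\<^sup>2 = (frob_norm B)\<^sup>2"
    by (rule frob_norm_mult_isometry_adjoint[OF isoQ]) simp
  also have "(frob_norm (?Qc * ?X))\<^sup>2 = (frob_norm ?X)\<^sup>2"
    by (rule frob_norm_isometry_mult) (simp_all add: adjc QQ)
  also have "(A * ?Qh) * mat_adjoint (transpose_mat B) = A * transpose_mat (mat_adjoint B * ?Qc)"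
  proof -
    have "transpose_mat (mat_adjoint B * ?Qc) = ?Qh * transpose_mat (mat_adjoint B)"
      by (subst transpose_mult[of _ p n _ p]) (auto intro: carrier_matI)
    then show ?thesis by (simp add: mat_adjoint_transpose mult_assoc_dim)
  qed
  then have "(A * ?Qh) * mat_adjoint (transpose_mat B) = 0\<^sub>m p p"
    unfolding BQc by (simp add: right_mult_zero_mat[OF A(1)])
  then have "(frob_norm ?X)\<^sup>2 = (frob_norm (A * ?Qh))\<^sup>2 + (frob_norm (transpose_mat B))\<^sup>2"
    by (intro frob_norm_add_orthogonal_rows) auto
  also have "(frob_norm (A * ?Qh))\<^sup>2 = (frob_norm A)\<^sup>2"
    by (rule frob_norm_mult_isometry_adjoint[OF isoQ]) simp
  finally show ?thesis by simp
qed

end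

text \<open>The second term carries the pseudoinverse of \<open>Tt\<close>, where the prose
  statement at the head has \<open>Tt\<close> itself: \<open>B\<close> is obtained by multiplying a
  component of \<open>R\<close> by that pseudoinverse.\<close>

theorem corollary3p4:
  fixes n p k :: nat
    and f :: "nat \<Rightarrow> complex \<Rightarrow> complex"
    and F :: "nat \<Rightarrow> real mat"
    and V R Q1 T Tt :: "complex mat"
    and lam :: "nat \<Rightarrow> complex"
  assumes "p \<le> n"
    and "\<And>j. j < k \<Longrightarrow> F j \<in> carrier_mat n n"
    and "\<And>j. j < k \<Longrightarrow> transpose_mat (F j) = F j"
    and "V \<in> carrier_mat n p"
    and "\<And>i. i < p \<Longrightarrow> col V i \<noteq> 0\<^sub>v n"
    and "conjugation_closed p k f V lam"
    and "R = residual_mat n p k f F V lam"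
    and "economy_qr n p V Q1 T"
    and "Tt = T_tilde p k f lam T"
  shows "(structured_backward_error n p k f F V lam)\<^sup>2
    \<le> (frob_norm R)\<^sup>2 *
       ((frob_norm (pseudoinverse (M_S p k Tt)))\<^sup>2 + 2 * (frob_norm (pseudoinverse Tt))\<^sup>2)"
proof -
  note F = assms(2,3) and V = assms(4) and R_def = assms(7) and Tt_def = assms(9)
  from assms(8) have Q: "Q1 \<in> carrier_mat n p" "mat_adjoint Q1 * Q1 = 1\<^sub>m p"
    and T: "T \<in> carrier_mat p p" and VQT: "V = Q1 * T"
    by (auto simp: economy_qr_def)
  let ?Fc = "\<lambda>j. map_mat complex_of_real (F j)" and ?L = "fun_Lambda p f lam"
    and ?Qt = "transpose_mat Q1" and ?Qc = "transpose_mat (mat_adjoint Q1)"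
  note [simp] = carrier_matD[OF Q(1)] carrier_matD[OF T]
  have Tt: "Tt \<in> carrier_mat (k * p) p" by (rule carrier_matI) (auto simp: Tt_def T_tilde_def)
  note [simp] = carrier_matD[OF Tt]
  have dimR [simp]: "dim_row R = n" "dim_col R = p" by (auto simp: R_def residual_mat_def)
  have QQ: "?Qt * ?Qc = 1\<^sub>m p"
    using arg_cong[OF Q(2), of transpose_mat]
    by (subst (asm) transpose_mult[of _ p n _ p]) (auto intro: carrier_matI)
  have Tt_index: "(X * Tt) $$ (r, i) = (\<Sum>j<k. (col_block n p X j * (T * ?L j)) $$ (r, i))"
    if "X \<in> carrier_mat n (k * p)" "r < n" "i < p" for X r i
    unfolding Tt_def T_tilde_def
    by (rule mult_block_col_index[OF that(1) _ that(2,3)]) (auto intro: carrier_matI)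

  \<comment> \<open>The block row of the products of \<open>F j\<close> with \<open>Q1\<close>.
    Since \<open>V = Q1 * T\<close>, the residual factors as \<open>FQ * Tt\<close>.\<close>
  define FQ where "FQ = mat n (k * p) (\<lambda>(r, c). (?Fc (c div p) * Q1) $$ (r, c mod p))"
  have FQ: "FQ \<in> carrier_mat n (k * p)" by (simp add: FQ_def)
  note [simp] = carrier_matD[OF FQ]
  have FQ_block: "col_block n p FQ j = ?Fc j * Q1" if "j < k" for j
    using that F(1)[OF that]
    by (intro eq_matI) (auto simp: FQ_def col_block_def mult_add_less simp del: index_mult_mat(1))
  have R: "R = FQ * Tt"
  proof (rule eq_matI)
    fix r i assume "r < dim_row (FQ * Tt)" "i < dim_col (FQ * Tt)"
    then have ri: "r < n" "i < p" by auto
    have "R $$ (r, i) = (\<Sum>j<k. (?Fc j * V * ?L j) $$ (r, i))"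
      using ri by (simp add: R_def residual_mat_def)
    also have "\<dots> = (\<Sum>j<k. (col_block n p FQ j * (T * ?L j)) $$ (r, i))"
    proof (rule sum.cong[OF refl])
      fix j assume "j \<in> {..<k}"
      then have j: "j < k" by simp
      have "?Fc j * V * ?L j = col_block n p FQ j * (T * ?L j)"
        using carrier_matD[OF F(1)[OF j]] by (simp add: FQ_block[OF j] VQT mult_assoc_dim)
      then show "(?Fc j * V * ?L j) $$ (r, i) = (col_block n p FQ j * (T * ?L j)) $$ (r, i)"
        by simp
    qed
    finally show "R $$ (r, i) = (FQ * Tt) $$ (r, i)"
      using Tt_index[OF FQ ri] by simp
  qed auto

  \<comment> \<open>The compression of the perturbation by \<open>- F j\<close>, with blocks
    \<open>- (?Qt * ?Fc j * Q1)\<close>. It witnesses that the system for \<open>A\<close> has a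
    solution with symmetric blocks.\<close>
  define A0 where "A0 = - (?Qt * FQ)"
  have A0: "A0 \<in> carrier_mat p (k * p)" by (rule carrier_matI) (auto simp: A0_def)
  have A0_Tt: "A0 * Tt = - (?Qt * R)"
    unfolding A0_def R by (simp add: mult_assoc_dim uminus_mult_left_mat)
  have "transpose_mat (col_block p p A0 j) = col_block p p A0 j" if j: "j < k" for j
  proof -
    note [simp] = carrier_matD[OF F(1)[OF j]]
    have "col_block p p A0 j = - (?Qt * col_block n p FQ j)"
      using mult_col_block[OF FQ _ j, of ?Qt] j
      by (intro eq_matI) (auto simp: A0_def col_block_def mult_add_less simp del: index_mult_mat(1))
    then have A0j: "col_block p p A0 j = - (?Qt * (?Fc j * Q1))"
      unfolding FQ_block[OF j] .
    have "transpose_mat (?Qt * (?Fc j * Q1)) = transpose_mat (?Fc j * Q1) * Q1"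
      by (subst transpose_mult[of _ p n _ p]) (auto intro: carrier_matI)
    also have "transpose_mat (?Fc j * Q1) = ?Qt * transpose_mat (?Fc j)"
      by (subst transpose_mult[of _ n n _ p]) (auto intro: carrier_matI)
    also have "transpose_mat (?Fc j) = ?Fc j"
      using F(2)[OF j] by (simp add: map_mat_transpose)
    finally show ?thesis
      unfolding A0j transpose_uminus by (simp add: mult_assoc_dim)
  qed
  from symmetric_blocks_solution[OF Tt A0 this] obtain A where A: "A \<in> carrier_mat p (k * p)"
    "A * Tt = - (?Qt * R)"
    "\<And>j. j < k \<Longrightarrow> transpose_mat (col_block p p A j) = col_block p p A j"
    "(frob_norm A)\<^sup>2 \<le> (frob_norm (pseudoinverse (M_S p k Tt)))\<^sup>2 * (frob_norm (?Qt * R))\<^sup>2"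
    unfolding A0_Tt frob_norm_uminus by blast
  note [simp] = carrier_matD[OF A(1)]

  \<comment> \<open>The component of \<open>R\<close> orthogonal to the columns of
    \<open>?Qc\<close>, standing in for the part of \<open>R\<close> seen by a unitary completion of
    \<open>Q1\<close>.\<close>
  define W where "W = R - ?Qc * (?Qt * R)"
  have [simp]: "dim_row W = n" "dim_col W = p" by (auto simp: W_def)
  have [simp]: "dim_row (pseudoinverse Tt) = p" "dim_col (pseudoinverse Tt) = k * p"
    using pseudoinverse_carrier[of Tt] by auto
  have carr_Tp: "pseudoinverse Tt \<in> carrier_mat p (k * p)" by (rule carrier_matI) auto
  define B where "B = - (W * pseudoinverse Tt)"
  have B: "B \<in> carrier_mat n (k * p)" by (rule carrier_matI) (auto simp: B_def)
  note [simp] = carrier_matD[OF B]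
  \<comment> \<open>\<open>W\<close> is a left multiple of \<open>Tt\<close>, so right
    multiplication by \<open>pseudoinverse Tt * Tt\<close> leaves it fixed and \<open>B\<close>
    solves its equation exactly.\<close>
  have "W = (FQ - ?Qc * (?Qt * FQ)) * Tt"
    unfolding W_def R by (simp add: minus_mult_dim mult_assoc_dim)
  then have "W * pseudoinverse Tt * Tt = (FQ - ?Qc * (?Qt * FQ)) * (Tt * pseudoinverse Tt * Tt)"
    by (simp add: mult_assoc_dim)
  also have "\<dots> = W"
    unfolding mult_pseudoinverse_mult using \<open>W = _ * Tt\<close> by simp
  finally have B_Tt: "B * Tt = - W"
    unfolding B_def by (simp add: uminus_mult_left_mat)
  have "?Qt * W = ?Qt * R - (?Qt * ?Qc) * (?Qt * R)"
    unfolding W_def by (simp add: mult_minus_dim mult_assoc_dim)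
  then have Qt_W: "?Qt * W = 0\<^sub>m p p"
    unfolding QQ by (simp add: minus_r_inv_mat[of _ p p] carrier_matI)
  have "?Qt * B = - (?Qt * W * pseudoinverse Tt)"
    unfolding B_def by (simp add: mult_assoc_dim uminus_mult_right_mat)
  then have Qt_B: "?Qt * B = 0\<^sub>m p (k * p)"
    unfolding Qt_W left_mult_zero_mat[OF carr_Tp] by (intro eq_matI) auto
  have Qt_Bj: "?Qt * col_block n p B j = 0\<^sub>m p p" if j: "j < k" for j
    unfolding mult_col_block[OF B _ j, of ?Qt, simplified] Qt_B using j
    by (intro eq_matI) (auto simp: col_block_def mult_add_less)

  define G where "G j = bordered Q1 (col_block p p A j) (col_block n p B j)" for j
  have carr: "col_block p p A j \<in> carrier_mat p p" "col_block n p B j \<in> carrier_mat n p" for j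
    by (auto intro: carrier_matI)
  note blocks = Q carr(1) A(3) carr(2) Qt_Bj
  have G: "G j \<in> carrier_mat n n" "transpose_mat (G j) = G j"
    "G j * Q1 = col_block n p (?Qc * A + B) j"
    "(frob_norm (G j))\<^sup>2 = (frob_norm (col_block p p A j))\<^sup>2 + 2 * (frob_norm (col_block n p B j))\<^sup>2"
    if j: "j < k" for j
  proof -
    show "G j \<in> carrier_mat n n"
      unfolding G_def by (rule bordered_carrier[OF blocks]) (rule j)+
    show "transpose_mat (G j) = G j"
      unfolding G_def by (rule bordered_symmetric[OF blocks]) (rule j)+
    show "(frob_norm (G j))\<^sup>2 = (frob_norm (col_block p p A j))\<^sup>2 + 2 * (frob_norm (col_block n p B j))\<^sup>2"
      unfolding G_def by (rule bordered_frob_norm[OF blocks]) (rule j)+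
    have "G j * Q1 = ?Qc * col_block p p A j + col_block n p B j"
      unfolding G_def by (rule bordered_mult[OF blocks]) (rule j)+
    also have "?Qc * col_block p p A j = col_block n p (?Qc * A) j"
      using mult_col_block[OF A(1) _ j, of ?Qc] by simp
    also have "col_block n p (?Qc * A) j + col_block n p B j = col_block n p (?Qc * A + B) j"
      using j by (intro eq_matI) (auto simp: col_block_def mult_add_less simp del: index_mult_mat(1))
    finally show "G j * Q1 = col_block n p (?Qc * A + B) j" .
  qed
  \<comment> \<open>The contributions of \<open>A\<close> and \<open>B\<close> are minus the two
    orthogonal components of \<open>R\<close>, so they add up to \<open>- R\<close>.\<close>
  have "(?Qc * A + B) * Tt = ?Qc * (A * Tt) + B * Tt"
    by (simp add: add_mult_dim mult_assoc_dim)
  also have "\<dots> = - (?Qc * (?Qt * R)) + - W"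
    unfolding A(2) B_Tt by (simp add: uminus_mult_right_mat)
  also have "\<dots> = - R"
    unfolding W_def by (intro eq_matI) (auto simp del: index_mult_mat(1))
  finally have X_Tt: "(?Qc * A + B) * Tt = - R" .
  have sol: "(\<Sum>j<k. (G j * V * ?L j) $$ (r, i)) = - residual_mat n p k f F V lam $$ (r, i)"
    if ri: "r < n" "i < p" for r i
  proof -
    have "(\<Sum>j<k. (G j * V * ?L j) $$ (r, i))
        = (\<Sum>j<k. (col_block n p (?Qc * A + B) j * (T * ?L j)) $$ (r, i))"
    proof (rule sum.cong[OF refl])
      fix j assume "j \<in> {..<k}"
      then have j: "j < k" by simp
      have "G j * V * ?L j = G j * Q1 * (T * ?L j)"
        using carrier_matD[OF G(1)[OF j]] by (simp add: VQT mult_assoc_dim)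
      then show "(G j * V * ?L j) $$ (r, i)
          = (col_block n p (?Qc * A + B) j * (T * ?L j)) $$ (r, i)"
        unfolding G(3)[OF j] by (rule arg_cong)
    qed
    also have "\<dots> = ((?Qc * A + B) * Tt) $$ (r, i)"
      by (rule Tt_index[symmetric, OF _ ri]) (auto intro: carrier_matI)
    also have "\<dots> = - residual_mat n p k f F V lam $$ (r, i)"
      unfolding X_Tt using ri by (simp add: R_def[symmetric])
    finally show ?thesis .
  qed

  have "(structured_backward_error n p k f F V lam)\<^sup>2 \<le> (\<Sum>j<k. (frob_norm (map_mat Re (G j)))\<^sup>2)"
    by (intro structured_backward_error_square_le
        admissible_perturbation_Re[OF F(1) V assms(6) G(1,2) sol])
  also have "\<dots> \<le> (\<Sum>j<k. (frob_norm (G j))\<^sup>2)"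
    by (intro sum_mono frob_norm_Re_square_le)
  also have "\<dots> = (frob_norm A)\<^sup>2 + 2 * (frob_norm B)\<^sup>2"
    unfolding frob_norm_square_blocks[OF A(1)] frob_norm_square_blocks[OF B]
    by (simp add: G(4) sum.distrib sum_distrib_left)
  also have "\<dots> \<le> (frob_norm (pseudoinverse (M_S p k Tt)))\<^sup>2 * (frob_norm (?Qt * R))\<^sup>2
      + 2 * ((frob_norm W)\<^sup>2 * (frob_norm (pseudoinverse Tt))\<^sup>2)"
    using A(4) frob_norm_mult_square_le[of W "pseudoinverse Tt"] by (simp add: B_def)
  also have "\<dots> \<le> (frob_norm R)\<^sup>2 *
       ((frob_norm (pseudoinverse (M_S p k Tt)))\<^sup>2 + 2 * (frob_norm (pseudoinverse Tt))\<^sup>2)"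
  proof -
    have adjc: "mat_adjoint ?Qc = ?Qt" by (simp add: mat_adjoint_transpose)
    \<comment> \<open>Pythagoras for the splitting of \<open>R\<close>: each component has norm at
      most that of \<open>R\<close>, so one factor \<open>(frob_norm R)\<^sup>2\<close> serves both
      terms.\<close>
    have "mat_adjoint (?Qc * (?Qt * R)) * W = mat_adjoint (?Qt * R) * (?Qt * W)"
      by (simp add: mat_adjoint_mult[of ?Qc] adjc mult_assoc_dim)
    also have "\<dots> = 0\<^sub>m p p"
      unfolding Qt_W by (rule right_mult_zero_mat) (auto intro: carrier_matI)
    finally have "(frob_norm (W + ?Qc * (?Qt * R)))\<^sup>2
        = (frob_norm W)\<^sup>2 + (frob_norm (?Qc * (?Qt * R)))\<^sup>2"
      by (intro frob_norm_add_orthogonal_cols) auto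
    moreover have "W + ?Qc * (?Qt * R) = R"
      unfolding W_def by (intro eq_matI) (auto simp del: index_mult_mat(1))
    moreover have "(frob_norm (?Qc * (?Qt * R)))\<^sup>2 = (frob_norm (?Qt * R))\<^sup>2"
      by (rule frob_norm_isometry_mult) (simp_all add: adjc QQ)
    ultimately have "(frob_norm R)\<^sup>2 = (frob_norm W)\<^sup>2 + (frob_norm (?Qt * R))\<^sup>2" by simp
    then show ?thesis by (simp add: algebra_simps)
  qed
  finally show ?thesis .
qed

end
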